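(* Let $\alpha,\beta>0$. (i) If $f\in\Lambda_H^\alpha$, then $(I-\Delta_d)^{-\beta/2}f\in\Lambda_H^{\alpha+\beta}$. (ii) If $f\in\ell^\infty(\mathbb{Z})$, then $(I-\Delta_d)^{-\beta/2}f\in\Lambda_H^{\beta}$.
   Context: Heat semigroup: $I_n(t)=\sum_{m=0}^\infty\frac{1}{m!\,\Gamma(m+n+1)}(t/2)^{2m+n}$ for $n\in\mathbb{N}_0$, $I_{-n}=I_n$; $G(t,n)=e^{-2t}I_n(2t)$ for $t>0$, $n\in\mathbb{Z}$; $e^{t\Delta_d}f(n)=\sum_{j\in\mathbb{Z}}G(t,n-j)f(j)$, where $\Delta_df(n)=f(n+1)-2f(n)+f(n-1)$. For $\alpha>0$, $\Lambda_H^\alpha$ is the set of $f:\mathbb{Z}\to\mathbb{R}$ with $\frac{f}{1+|\cdot|^\alpha}\in\ell^\infty(\mathbb{Z})$ for which there is $C_\alpha>0$ with $\|\partial_t^ke^{t\Delta_d}f\|_\infty\le C_\alpha t^{-k+\alpha/2}$ for all $t>0$, where $k=[\alpha/2]+1$, $[\cdot]$ is the integer part and $\|\cdot\|_\infty$ is the supremum norm over $\mathbb{Z}$. The Bessel potential of order $\beta>0$ is $(I-\Delta_d)^{-\beta/2}f(n)=\frac{1}{\Gamma(\beta/2)}\int_0^\infty e^{-\tau}e^{\tau\Delta_d}f(n)\,\tau^{\beta/2}\frac{d\tau}{\tau}$, $n\in\mathbb{Z}$. Functions are real-valued on $\mathbb{Z}$. *)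

theory Defs
  imports "HOL-Analysis.Analysis"
begin

definition bessel_I_nat :: "nat \<Rightarrow> real \<Rightarrow> real" where
  "bessel_I_nat n t = (\<Sum>m. 1 / (fact m * Gamma (real m + real n + 1)) * (t / 2) ^ (2 * m + n))"

text \<open>Modified Bessel functions of the first kind of integer order, with \<open>I\<^sub>-\<^sub>n = I\<^sub>n\<close>.\<close>

definition bessel_I :: "int \<Rightarrow> real \<Rightarrow> real" where
  "bessel_I n t = bessel_I_nat (nat \<bar>n\<bar>) t"

definition heat_kernel :: "real \<Rightarrow> int \<Rightarrow> real" where
  "heat_kernel t n = exp (- 2 * t) * bessel_I n (2 * t)"

text \<open>The semigroup generated by the discrete Laplacian \<open>f (n + 1) - 2 * f n + f (n - 1)\<close>.
  For \<open>t > 0\<close> the series converges absolutely for every \<open>f\<close> of polynomial growth, so the default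
  value of \<open>infsum\<close> plays no role for the functions considered below.\<close>

definition heat_semigroup :: "real \<Rightarrow> (int \<Rightarrow> real) \<Rightarrow> int \<Rightarrow> real" where
  "heat_semigroup t f n = (\<Sum>\<^sub>\<infinity>j\<in>UNIV. heat_kernel t (n - j) * f j)"

text \<open>The supremum norm is extended-real valued, so that it is \<open>\<infinity>\<close> for unbounded functions.\<close>

definition sup_norm :: "(int \<Rightarrow> real) \<Rightarrow> ereal" where
  "sup_norm f = (SUP n. ereal \<bar>f n\<bar>)"

definition ell_infty :: "(int \<Rightarrow> real) set" where
  "ell_infty = {f. sup_norm f < \<infinity>}"

text \<open>Intended for \<open>\<alpha> > 0\<close>. The growth condition makes \<open>heat_semigroup t f n\<close> smooth in \<open>t > 0\<close>, so
  the iterated \<open>deriv\<close> is the genuine derivative of order \<open>k\<close>.\<close>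

definition Lambda_H :: "real \<Rightarrow> (int \<Rightarrow> real) set" where
  "Lambda_H \<alpha> = {f.
     (\<lambda>n. f n / (1 + \<bar>real_of_int n\<bar> powr \<alpha>)) \<in> ell_infty \<and>
     (let k = nat \<lfloor>\<alpha> / 2\<rfloor> + 1 in
       \<exists>C::real. \<forall>t>0.
         sup_norm (\<lambda>n. (deriv ^^ k) (\<lambda>s. heat_semigroup s f n) t)
           \<le> ereal (C * t powr (- real k + \<alpha> / 2)))}"

text \<open>The Bessel potential of order \<open>\<beta> > 0\<close>, that is, the power \<open>- \<beta> / 2\<close> of the identity minus the
  discrete Laplacian. The integral converges absolutely for \<open>f\<close> of polynomial growth.\<close>

definition bessel_potential :: "real \<Rightarrow> (int \<Rightarrow> real) \<Rightarrow> int \<Rightarrow> real" where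
  "bessel_potential \<beta> f n =
     1 / Gamma (\<beta> / 2) *
     (LINT \<tau>:{0<..}|lborel. exp (- \<tau>) * heat_semigroup \<tau> f n * \<tau> powr (\<beta> / 2) / \<tau>)"

end

theory Submission
  imports Defs "HOL-Real_Asymp.Real_Asymp"
begin

text \<open>
Write \<open>\<Delta>\<close> for the discrete Laplacian and \<open>u t = exp (t * \<Delta>) f\<close> for the heat flow. The Bessel potential
\<open>J f\<close> of order \<open>\<beta>\<close> is an average over \<open>\<tau>\<close> of \<open>u \<tau>\<close>, so the semigroup law gives
\<open>exp (t * \<Delta>) (J f) = c * (\<integral> exp (- \<tau>) * \<tau> powr (\<beta> / 2 - 1) * u (t + \<tau>) d\<tau>)\<close>. If the derivative of order
\<open>m\<close> of \<open>u\<close> is bounded by a multiple of \<open>t powr (\<alpha> / 2 - m)\<close>, then that of the flow of \<open>J f\<close> is bounded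
by a multiple of \<open>\<integral> \<tau> powr (\<beta> / 2 - 1) * (t + \<tau>) powr (\<alpha> / 2 - m) d\<tau>\<close>. This integral converges if
\<open>m > (\<alpha> + \<beta>) / 2\<close>, and then it scales as \<open>t powr ((\<alpha> + \<beta>) / 2 - m)\<close>: the potential gains \<open>\<beta> / 2\<close> powers
of \<open>t\<close> (\<open>gamma_avg_decay\<close>). The factor \<open>exp (- \<tau>)\<close> makes \<open>J f\<close> itself converge and keeps its growth
within that of \<open>f\<close>.

The class of order \<open>\<alpha>\<close> controls a derivative of order \<open>k\<close>, while the target class asks for an order \<open>m\<close>
that may be larger. The missing \<open>m - k\<close> derivatives come from the smoothing estimate
\<open>\<bar>exp (t * \<Delta>) (\<Delta> h) n\<bar> \<le> M / t\<close> for functions \<open>h\<close> bounded by \<open>M\<close> (\<open>heat_semigroup_lap_bound\<close>). The heat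
kernel is the law of the difference of two independent Poisson variables of mean \<open>t\<close>, and \<open>\<Delta>\<close> is a product of
a forward and a backward difference; each of these costs \<open>1 / sqrt t\<close>, the relative standard deviation
of a Poisson variable.

All the interchanges of limits rest on one representation: \<open>exp (t * \<Delta>) f\<close> is \<open>exp (- 2 * t)\<close> times the
exponential series of the neighbour sum \<open>f (n + 1) + f (n - 1)\<close> (\<open>heat_semigroup_eq\<close>), which converges for
every exponentially bounded function. It turns time derivatives into powers of \<open>\<Delta>\<close>
(\<open>deriv_heat_semigroup\<close>), and since those commute with \<open>J\<close>, the integral is never differentiated. Growth is
controlled by comparison with hyperbolic cosines centred at an arbitrary point, which are
eigenfunctions of the neighbour sum; centring at the point of evaluation recovers polynomial growth
(\<open>heat_semigroup_poly_growth\<close>).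
\<close>

section \<open>Exponentially bounded functions on the integers\<close>

text \<open>The discrete Laplacian is the neighbour sum minus twice the identity, and these two commute, so its
semigroup is \<open>exp (- 2 * t)\<close> times the exponential of \<open>t\<close> times the neighbour sum. The neighbour
sum, unlike the Laplacian, preserves pointwise domination by positive functions, and this is why it
carries the estimates.\<close>

definition nbr_sum :: "(int \<Rightarrow> real) \<Rightarrow> int \<Rightarrow> real" where
  "nbr_sum f n = f (n + 1) + f (n - 1)"

definition lap :: "(int \<Rightarrow> real) \<Rightarrow> int \<Rightarrow> real" where
  "lap f n = f (n + 1) - 2 * f n + f (n - 1)"

text \<open>This weight is \<open>2 * cosh (n * ln 2)\<close>, an eigenfunction of the neighbour sum. A hyperbolic cosine is
an eigenfunction for any rate; the rate \<open>ln 2\<close> makes the eigenvalue \<open>5 / 2\<close>, so that the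
heat semigroup multiplies the weight by \<open>exp (t / 2)\<close>, which the factor \<open>exp (- \<tau>)\<close> of the Bessel
potential absorbs.\<close>

definition exp_weight :: "int \<Rightarrow> real" where
  "exp_weight n = 2 powi n + 2 powi (- n)"

definition exp_bounded :: "(int \<Rightarrow> real) \<Rightarrow> bool" where
  "exp_bounded f \<longleftrightarrow> (\<exists>M. \<forall>n. \<bar>f n\<bar> \<le> M * exp_weight n)"

definition exp_nbr :: "real \<Rightarrow> (int \<Rightarrow> real) \<Rightarrow> int \<Rightarrow> real" where
  "exp_nbr t f n = (\<Sum>k. t ^ k / fact k * (nbr_sum ^^ k) f n)"

lemma exp_weight_pos: "exp_weight n > 0"
  by (simp add: exp_weight_def add_pos_pos)

lemma nbr_sum_exp_weight: "nbr_sum exp_weight n = 5 / 2 * exp_weight n"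
proof -
  have "(2::real) powi (n + 1) = 2 powi n * 2" "(2::real) powi (n - 1) = 2 powi n / 2"
    "(2::real) powi (- (n + 1)) = 2 powi (- n) / 2" "(2::real) powi (- (n - 1)) = 2 powi (- n) * 2"
    by (auto simp: power_int_add power_int_diff power_int_minus field_simps)
  then show ?thesis
    by (simp add: nbr_sum_def exp_weight_def field_simps)
qed

text \<open>Since the neighbour sum is a positive operator, a supersolution \<open>w\<close> that dominates \<open>f\<close> at the start
keeps dominating it. The two weights used below are constants, with \<open>c = 2\<close>, and translates of
multiples of \<open>exp_weight\<close>, with \<open>c = 5 / 2\<close>.\<close>

lemma nbr_sum_pow_bound:
  assumes "\<And>n. \<bar>f n\<bar> \<le> w n" and "\<And>n. nbr_sum w n \<le> c * w n" and "c \<ge> 0"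
  shows "\<bar>(nbr_sum ^^ k) f n\<bar> \<le> c ^ k * w n"
proof (induction k arbitrary: n)
  case (Suc k)
  have "\<bar>(nbr_sum ^^ Suc k) f n\<bar> \<le> c ^ k * w (n + 1) + c ^ k * w (n - 1)"
    using Suc[of "n + 1"] Suc[of "n - 1"] nbr_sum_def[of "(nbr_sum ^^ k) f" n] by simp
  also have "\<dots> = c ^ k * nbr_sum w n"
    by (simp add: nbr_sum_def algebra_simps)
  also have "\<dots> \<le> c ^ k * (c * w n)"
    using assms by (intro mult_left_mono) auto
  finally show ?case by (simp add: mult_ac)
qed (use assms in auto)

lemma nbr_sum_scaled_exp_weight: "nbr_sum (\<lambda>n. M * exp_weight n) n \<le> 5 / 2 * (M * exp_weight n)"
proof -
  have "nbr_sum (\<lambda>n. M * exp_weight n) n = M * nbr_sum exp_weight n"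
    by (simp add: nbr_sum_def algebra_simps)
  then show ?thesis by (simp add: nbr_sum_exp_weight)
qed

lemma exp_boundedE:
  assumes "exp_bounded f"
  obtains M where "M \<ge> 0" "\<And>n. \<bar>f n\<bar> \<le> M * exp_weight n"
    "\<And>k n. \<bar>(nbr_sum ^^ k) f n\<bar> \<le> (5 / 2) ^ k * (M * exp_weight n)"
proof -
  from assms obtain M where M: "\<And>n. \<bar>f n\<bar> \<le> M * exp_weight n"
    unfolding exp_bounded_def by blast
  have "0 \<le> M * exp_weight 0"
    using M[of 0] by linarith
  then have "M \<ge> 0"
    using exp_weight_pos[of 0] by (simp add: zero_le_mult_iff)
  moreover have "\<bar>(nbr_sum ^^ k) f n\<bar> \<le> (5 / 2) ^ k * (M * exp_weight n)" for k n
    by (rule nbr_sum_pow_bound) (use M nbr_sum_scaled_exp_weight in auto)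
  ultimately show ?thesis using M that by blast
qed

lemma exp_bounded_nbr_sum_pow:
  assumes "exp_bounded f"
  shows "exp_bounded ((nbr_sum ^^ k) f)"
proof -
  obtain M where "\<And>k n. \<bar>(nbr_sum ^^ k) f n\<bar> \<le> (5 / 2) ^ k * (M * exp_weight n)"
    using exp_boundedE[OF assms] by metis
  then have "\<bar>(nbr_sum ^^ k) f n\<bar> \<le> (5 / 2) ^ k * M * exp_weight n" for n
    by (simp only: mult.assoc)
  then show ?thesis unfolding exp_bounded_def by blast
qed

lemma exp_bounded_linear:
  assumes "exp_bounded f" "exp_bounded g"
  shows "exp_bounded (\<lambda>n. a * f n + b * g n)"
proof -
  obtain M N where M: "\<And>n. \<bar>f n\<bar> \<le> M * exp_weight n" and N: "\<And>n. \<bar>g n\<bar> \<le> N * exp_weight n"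
    using assms unfolding exp_bounded_def by blast
  have "\<bar>a * f n + b * g n\<bar> \<le> (\<bar>a\<bar> * M + \<bar>b\<bar> * N) * exp_weight n" for n
  proof -
    have "\<bar>a * f n + b * g n\<bar> \<le> \<bar>a\<bar> * \<bar>f n\<bar> + \<bar>b\<bar> * \<bar>g n\<bar>"
      by (metis abs_mult abs_triangle_ineq)
    also have "\<dots> \<le> \<bar>a\<bar> * (M * exp_weight n) + \<bar>b\<bar> * (N * exp_weight n)"
      by (intro add_mono mult_left_mono M N) auto
    finally show ?thesis by (simp add: algebra_simps)
  qed
  then show ?thesis unfolding exp_bounded_def by blast
qed

lemma lap_eq: "lap f = (\<lambda>n. nbr_sum f n - 2 * f n)"
  by (auto simp: lap_def nbr_sum_def)

lemma exp_bounded_lap: "exp_bounded f \<Longrightarrow> exp_bounded (lap f)"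
  using exp_bounded_linear[of "nbr_sum f" f 1 "-2"] exp_bounded_nbr_sum_pow[of f 1]
  by (simp add: lap_eq)

lemma exp_bounded_lap_pow: "exp_bounded f \<Longrightarrow> exp_bounded ((lap ^^ k) f)"
  by (induction k) (auto intro: exp_bounded_lap)

section \<open>The heat semigroup as an exponential series\<close>

lemma summable_exp_real: "summable (\<lambda>k. x ^ k / fact k :: real)"
  using summable_exp[of x] by (simp add: field_simps)

lemma exp_sums_real: "(\<lambda>k. x ^ k / fact k) sums exp (x::real)"
  using exp_converges[of x] by (simp add: field_simps)

lemma exp_nbr_summable:
  assumes "exp_bounded f"
  shows "summable (\<lambda>k. \<bar>t ^ k / fact k * (nbr_sum ^^ k) f n\<bar>)"
proof -
  obtain M where M: "\<And>k n. \<bar>(nbr_sum ^^ k) f n\<bar> \<le> (5 / 2) ^ k * (M * exp_weight n)"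
    using exp_boundedE[OF assms] by metis
  have "summable (\<lambda>k. (\<bar>t\<bar> * (5 / 2)) ^ k / fact k * (M * exp_weight n))"
    by (intro summable_mult2 summable_exp_real)
  then show ?thesis
  proof (rule summable_comparison_test'[where N = 0])
    fix k :: nat
    have "\<bar>t\<bar> ^ k / fact k * \<bar>(nbr_sum ^^ k) f n\<bar> \<le> \<bar>t\<bar> ^ k / fact k * ((5 / 2) ^ k * (M * exp_weight n))"
      by (intro mult_left_mono M) auto
    then show "norm \<bar>t ^ k / fact k * (nbr_sum ^^ k) f n\<bar>
        \<le> (\<bar>t\<bar> * (5 / 2)) ^ k / fact k * (M * exp_weight n)"
      by (simp add: abs_mult power_abs power_mult_distrib power_divide mult_ac)
  qed
qed

lemma exp_nbr_sums:
  assumes "exp_bounded f"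
  shows "(\<lambda>k. t ^ k / fact k * (nbr_sum ^^ k) f n) sums exp_nbr t f n"
  unfolding exp_nbr_def
  by (rule summable_sums, rule summable_rabs_cancel, rule exp_nbr_summable, fact)

text \<open>Summing the bounds for the powers gives the exponential of \<open>c * t\<close>, without any loss; a bound through
the operator norm of the Laplacian itself would give a rate of at least \<open>4\<close>, too large for the
Bessel potential to converge.\<close>

lemma exp_nbr_bound:
  assumes "\<And>n. \<bar>f n\<bar> \<le> w n" and "\<And>n. nbr_sum w n \<le> c * w n" and "c \<ge> 0" and "t \<ge> 0"
  shows "\<bar>exp_nbr t f n\<bar> \<le> exp (c * t) * w n"
proof -
  have le: "\<bar>t ^ k / fact k * (nbr_sum ^^ k) f n\<bar> \<le> (c * t) ^ k / fact k * w n" for k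
  proof -
    have "t ^ k / fact k * \<bar>(nbr_sum ^^ k) f n\<bar> \<le> t ^ k / fact k * (c ^ k * w n)"
      using assms by (intro mult_left_mono nbr_sum_pow_bound) auto
    then show ?thesis using assms(4) by (simp add: abs_mult power_mult_distrib mult_ac)
  qed
  have sums: "(\<lambda>k. (c * t) ^ k / fact k * w n) sums (exp (c * t) * w n)"
    by (intro sums_mult2 exp_sums_real)
  have s: "summable (\<lambda>k. \<bar>t ^ k / fact k * (nbr_sum ^^ k) f n\<bar>)"
    by (rule summable_comparison_test'[OF sums_summable[OF sums], of 0]) (use le in auto)
  have "\<bar>exp_nbr t f n\<bar> \<le> (\<Sum>k. \<bar>t ^ k / fact k * (nbr_sum ^^ k) f n\<bar>)"
    unfolding exp_nbr_def by (rule summable_rabs[OF s])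
  also have "\<dots> \<le> exp (c * t) * w n"
    using suminf_le[OF le s sums_summable[OF sums]] sums_unique[OF sums] by simp
  finally show ?thesis .
qed

text \<open>Unconditional summation over pairs of naturals, grouped along the antidiagonals. Both the link with
the Bessel functions and the semigroup law are instances of this rearrangement.\<close>

lemma sums_diagonal:
  fixes F :: "nat \<times> nat \<Rightarrow> real"
  assumes "F summable_on UNIV"
  shows "(\<lambda>k. \<Sum>i\<le>k. F (i, k - i)) sums infsum F UNIV"
proof -
  have "((\<lambda>(k, i). F (i, k - i)) has_sum infsum F UNIV) (SIGMA k:UNIV. {..k})
      = (F has_sum infsum F UNIV) UNIV"
    by (rule has_sum_reindex_bij_witness[where i = "\<lambda>(i, j). (i + j, i)" and j = "\<lambda>(k, i). (i, k - i)"])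
       auto
  then have "((\<lambda>(k, i). F (i, k - i)) has_sum infsum F UNIV) (SIGMA k:UNIV. {..k})"
    using assms by simp
  then have "((\<lambda>k. \<Sum>i\<le>k. F (i, k - i)) has_sum infsum F UNIV) UNIV"
    by (rule has_sum_SigmaD) (auto intro: has_sum_finiteI)
  then show ?thesis by (rule has_sum_imp_sums)
qed

lemma summable_exp_product:
  fixes x y :: real
  assumes "x \<ge> 0" "y \<ge> 0"
  shows "(\<lambda>(p, q). x ^ p / fact p * (y ^ q / fact q)) summable_on (UNIV :: (nat \<times> nat) set)"
proof -
  have s: "((\<lambda>q. z ^ q / fact q) has_sum exp z) UNIV" if "z \<ge> 0" for z :: real
    using that norm_summable_imp_has_sum[OF _ exp_sums_real[of z]] summable_exp_real[of z] by simp
  have "(\<lambda>(p, q). x ^ p / fact p * (y ^ q / fact q)) summable_on (UNIV \<times> (UNIV :: nat set))"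
  proof (rule summable_on_SigmaI)
    fix p :: nat
    show "((\<lambda>q. case (p, q) of (p, q) \<Rightarrow> x ^ p / fact p * (y ^ q / fact q)) has_sum (x ^ p / fact p * exp y)) UNIV"
      unfolding prod.case by (rule has_sum_cmult_right[OF s[OF assms(2)]])
  next
    show "(\<lambda>p. x ^ p / fact p * exp y) summable_on UNIV"
      using s[OF assms(1)] has_sum_imp_summable by (intro summable_on_cmult_left) blast
  qed (use assms in auto)
  then show ?thesis by simp
qed

lemma nbr_sum_pow_binomial:
  "(nbr_sum ^^ k) f n = (\<Sum>i\<le>k. real (k choose i) * f (n + int i - int (k - i)))"
proof (induction k arbitrary: n)
  case (Suc k)
  let ?g = "\<lambda>i. f (n + 2 * int i - int (Suc k))"
  have g: "f (n + int i - int (Suc k - i)) = ?g i" if "i \<le> Suc k" for i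
    using that by (intro arg_cong[of _ _ f]) auto
  have 1: "f (n + 1 + int i - int (k - i)) = ?g (Suc i)" "f (n - 1 + int i - int (k - i)) = ?g i"
    if "i \<le> k" for i
    using that by (auto intro!: arg_cong[of _ _ f])
  have "(nbr_sum ^^ Suc k) f n = (nbr_sum ^^ k) f (n + 1) + (nbr_sum ^^ k) f (n - 1)"
    by (simp add: nbr_sum_def[of "(nbr_sum ^^ k) f" n])
  also have "\<dots> = (\<Sum>i\<le>k. real (k choose i) * ?g (Suc i)) + (\<Sum>i\<le>k. real (k choose i) * ?g i)"
    unfolding Suc.IH by (intro arg_cong2[of _ _ _ _ "(+)"] sum.cong refl) (use 1 in auto)
  also have "(\<Sum>i\<le>k. real (k choose i) * ?g i) = ?g 0 + (\<Sum>i\<le>k. real (k choose Suc i) * ?g (Suc i))"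
    using sum.atMost_Suc_shift[of "\<lambda>i. real (k choose i) * ?g i" k]
      binomial_eq_0[of k "Suc k"] by simp
  also have "(\<Sum>i\<le>k. real (k choose i) * ?g (Suc i)) + \<dots> = (\<Sum>i\<le>Suc k. real (Suc k choose i) * ?g i)"
    by (simp add: sum.atMost_Suc_shift sum.distrib algebra_simps del: sum.atMost_Suc)
  also have "\<dots> = (\<Sum>i\<le>Suc k. real (Suc k choose i) * f (n + int i - int (Suc k - i)))"
    by (intro sum.cong refl) (use g in auto)
  finally show ?case .
qed simp

lemma exp_weight_le: "exp_weight (n + int p - int q) \<le> exp_weight n * (2 ^ p * 2 ^ q)"
proof -
  have 1: "(2::real) powi (n + int p - int q) = 2 powi n * 2 ^ p / 2 ^ q"
    "(2::real) powi (-(n + int p - int q)) = 2 powi (- n) * 2 ^ q / 2 ^ p"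
    using power_int_diff[of "2::real" "n + int p" "int q"] power_int_add[of "2::real" n "int p"]
      power_int_diff[of "2::real" "- n + int q" "int p"] power_int_add[of "2::real" "- n" "int q"]
    by (simp_all add: algebra_simps)
  \<comment> \<open>The bound is wasteful in one of the two indices, but symmetric, so that it serves both summands.\<close>
  have 2: "x * 2 ^ p / 2 ^ q \<le> x * (2 ^ p * 2 ^ q)" if "x > 0" for x :: real and p q
  proof -
    have "x * 2 ^ p / 2 ^ q \<le> x * 2 ^ p / 1"
      using that by (intro divide_left_mono) auto
    also have "\<dots> \<le> x * 2 ^ p * 2 ^ q"
      using that mult_left_mono[of 1 "2 ^ q" "x * 2 ^ p"] by simp
    finally show ?thesis by (simp add: mult_ac)
  qed
  show ?thesis
    using 2[of "2 powi n" p q] 2[of "2 powi (- n)" q p]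
    by (simp only: exp_weight_def 1) (simp add: algebra_simps)
qed

lemma double_sum_summable:
  assumes "exp_bounded f"
  shows "(\<lambda>(p, q). t ^ p / fact p * (t ^ q / fact q) * f (n + int p - int q)) summable_on UNIV"
    (is "?F summable_on _")
proof (rule abs_summable_summable)
  obtain M where M: "M \<ge> 0" "\<And>n. \<bar>f n\<bar> \<le> M * exp_weight n"
    using exp_boundedE[OF assms] by metis
  let ?g = "\<lambda>(p, q). (2 * \<bar>t\<bar>) ^ p / fact p * ((2 * \<bar>t\<bar>) ^ q / fact q)"
  have "(\<lambda>pq. ?g pq * (M * exp_weight n)) summable_on UNIV"
    by (intro summable_on_cmult_left summable_exp_product) auto
  then show "(\<lambda>pq. norm (?F pq)) summable_on UNIV"
  proof (rule Infinite_Sum.abs_summable_on_comparison_test', safe)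
    fix p q :: nat
    have "\<bar>f (n + int p - int q)\<bar> \<le> M * (exp_weight n * (2 ^ p * 2 ^ q))"
      using M(2) exp_weight_le by (rule order_trans[OF _ mult_left_mono]) fact
    then have "\<bar>t\<bar> ^ p / fact p * (\<bar>t\<bar> ^ q / fact q) * \<bar>f (n + int p - int q)\<bar>
        \<le> \<bar>t\<bar> ^ p / fact p * (\<bar>t\<bar> ^ q / fact q) * (M * (exp_weight n * (2 ^ p * 2 ^ q)))"
      by (intro mult_left_mono) auto
    then show "norm (t ^ p / fact p * (t ^ q / fact q) * f (n + int p - int q))
        \<le> (2 * \<bar>t\<bar>) ^ p / fact p * ((2 * \<bar>t\<bar>) ^ q / fact q) * (M * exp_weight n)"
      by (simp add: abs_mult power_abs power_mult_distrib mult_ac)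
  qed
qed

text \<open>The neighbour sum is the sum of the two commuting shifts, so its exponential is the product of their
exponentials: by the binomial theorem, the antidiagonal \<open>p + q = k\<close> contributes exactly the term of
order \<open>k\<close> of the exponential series.\<close>

lemma double_sum_eq_exp_nbr:
  assumes "exp_bounded f"
  shows "((\<lambda>(p, q). t ^ p / fact p * (t ^ q / fact q) * f (n + int p - int q)) has_sum exp_nbr t f n) UNIV"
    (is "(?F has_sum _) _")
proof -
  have s: "?F summable_on UNIV"
    by (rule double_sum_summable[OF assms])
  have eq: "(\<Sum>i\<le>k. ?F (i, k - i)) = t ^ k / fact k * (nbr_sum ^^ k) f n" for k
    unfolding nbr_sum_pow_binomial sum_distrib_left
  proof (intro sum.cong refl)
    fix i assume "i \<in> {..k}"
    then have "t ^ k = t ^ i * t ^ (k - i)" "real (k choose i) = fact k / (fact i * fact (k - i))"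
      by (auto simp: binomial_fact power_add[symmetric])
    then show "?F (i, k - i) = t ^ k / fact k * (real (k choose i) * f (n + int i - int (k - i)))"
      by simp
  qed
  have "(\<lambda>k. t ^ k / fact k * (nbr_sum ^^ k) f n) sums infsum ?F UNIV"
    using sums_diagonal[OF s] unfolding eq .
  then have "infsum ?F UNIV = exp_nbr t f n"
    by (rule sums_unique2[OF _ exp_nbr_sums[OF assms]])
  with has_sum_infsum[OF s] show ?thesis by (simp only:)
qed

text \<open>The coefficient of \<open>f j\<close> in the double series over \<open>p\<close> and \<open>q\<close> collects the pairs with
\<open>p - q = j - n\<close>. Parametrised by \<open>m = min p q\<close>, they give the power series of the Bessel function of
order \<open>\<bar>n - j\<bar>\<close> at \<open>2 * t\<close>. The identity holds for every real \<open>t\<close>, which lets derivatives in \<open>t\<close> be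
iterated as derivatives of functions on the whole line.\<close>

lemma heat_semigroup_eq:
  assumes "exp_bounded f"
  shows "heat_semigroup t f n = exp (- 2 * t) * exp_nbr t f n"
proof -
  let ?F = "\<lambda>(p, q). t ^ p / fact p * (t ^ q / fact q) * f (n + int p - int q)"
  let ?d = "\<lambda>j. nat \<bar>n - j\<bar>"
  let ?G = "\<lambda>(j, m). 1 / (fact m * Gamma (real m + real (?d j) + 1)) * t ^ (2 * m + ?d j) * f j"
  have "(?G has_sum exp_nbr t f n) (UNIV \<times> UNIV) = (?F has_sum exp_nbr t f n) UNIV"
  proof (rule has_sum_reindex_bij_witness[where j = "\<lambda>(j, m). (m + nat (j - n), m + nat (n - j))"
        and i = "\<lambda>(p, q). (n + int p - int q, min p q)"])
    fix jm :: "int \<times> nat"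
    obtain j m where [simp]: "jm = (j, m)" by force
    have G: "Gamma (real m + real (?d j) + 1) = fact (m + ?d j)"
      using Gamma_fact[of "m + ?d j", where ?'a = real] by (simp add: add_ac)
    have t: "t ^ (2 * m + ?d j) = t ^ m * t ^ (m + ?d j)"
      by (simp add: mult_2 add.assoc flip: power_add)
    show "?F (case jm of (j, m) \<Rightarrow> (m + nat (j - n), m + nat (n - j))) = ?G jm"
    proof (cases "j \<ge> n")
      case True
      then have "nat (n - j) = 0" "nat (j - n) = ?d j" "n + int (m + nat (j - n)) - int m = j"
        by auto
      then show ?thesis using True
        by (simp only: \<open>jm = _\<close> prod.case G t) (simp add: mult_ac)
    next
      case False
      then have "nat (j - n) = 0" "nat (n - j) = ?d j" "n + int m - int (m + nat (n - j)) = j"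
        by auto
      then show ?thesis using False
        by (simp only: \<open>jm = _\<close> prod.case G t) (simp add: mult_ac)
    qed
  qed (auto split: prod.splits)
  then have G: "(?G has_sum exp_nbr t f n) (UNIV \<times> UNIV)"
    using double_sum_eq_exp_nbr[OF assms] by simp
  have "((\<lambda>j. bessel_I (n - j) (2 * t) * f j) has_sum exp_nbr t f n) UNIV"
  proof (rule has_sum_SigmaD[OF G])
    fix j
    let ?g = "\<lambda>m. 1 / (fact m * Gamma (real m + real (?d j) + 1)) * t ^ (2 * m + ?d j)"
    have "(\<lambda>m. ?G (j, m)) summable_on UNIV"
      using summable_on_SigmaD1[of "\<lambda>j m. ?G (j, m)" UNIV "\<lambda>_. UNIV" j] has_sum_imp_summable[OF G]
      by simp
    then have 1: "((\<lambda>m. ?G (j, m)) has_sum (\<Sum>\<^sub>\<infinity>m. ?G (j, m))) UNIV"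
      by simp
    have a: "(\<lambda>m. ?g m * f j) sums (\<Sum>\<^sub>\<infinity>m. ?G (j, m))"
      using has_sum_imp_sums[OF 1] by (simp only: prod.case)
    have b: "(\<lambda>m. ?g m * f j) sums (bessel_I (n - j) (2 * t) * f j)"
    proof -
      have "summable ?g"
      proof (rule summable_comparison_test'[where N = 0])
        show "summable (\<lambda>m. (t\<^sup>2) ^ m / fact m * \<bar>t\<bar> ^ ?d j)"
          by (intro summable_mult2 summable_exp_real)
        fix m
        have G: "Gamma (real m + real (?d j) + 1) = fact (m + ?d j)"
          using Gamma_fact[of "m + ?d j", where ?'a = real] by (simp add: add_ac)
        have "\<bar>t\<bar> ^ (2 * m + ?d j) / fact m / fact (m + ?d j) \<le> \<bar>t\<bar> ^ (2 * m + ?d j) / fact m / 1"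
          by (intro divide_left_mono) auto
        then show "norm (?g m) \<le> (t\<^sup>2) ^ m / fact m * \<bar>t\<bar> ^ ?d j"
          unfolding G by (simp add: abs_mult power_abs power_mult power_add)
      qed
      then have "(\<lambda>m. ?g m * f j) sums (suminf ?g * f j)"
        by (intro sums_mult2 summable_sums)
      also have "suminf ?g = bessel_I (n - j) (2 * t)"
        unfolding bessel_I_def bessel_I_nat_def by simp
      finally show ?thesis .
    qed
    show "((\<lambda>m. ?G (j, m)) has_sum bessel_I (n - j) (2 * t) * f j) UNIV"
      using 1 unfolding sums_unique2[OF a b] .
  qed
  then have "((\<lambda>j. exp (- 2 * t) * (bessel_I (n - j) (2 * t) * f j)) has_sum (exp (- 2 * t) * exp_nbr t f n)) UNIV"
    by (rule has_sum_cmult_right)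
  then show ?thesis
    unfolding heat_semigroup_def heat_kernel_def by (simp add: infsumI mult.assoc)
qed

section \<open>Time derivatives and the semigroup law\<close>

lemma nbr_sum_pow_add: "(nbr_sum ^^ k) ((nbr_sum ^^ j) f) = (nbr_sum ^^ (j + k)) f"
  by (metis add.commute comp_apply funpow_add)

lemma nbr_sum_pow_linear:
  "(nbr_sum ^^ k) (\<lambda>n. a * f n + b * g n) = (\<lambda>n. a * (nbr_sum ^^ k) f n + b * (nbr_sum ^^ k) g n)"
proof (induction k)
  case (Suc k)
  have "nbr_sum (\<lambda>n. a * F n + b * G n) = (\<lambda>n. a * nbr_sum F n + b * nbr_sum G n)" for F G
    by (rule ext) (simp add: nbr_sum_def algebra_simps)
  then show ?case by (simp add: Suc)
qed simp

lemma exp_nbr_linear: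
  assumes "exp_bounded f" "exp_bounded g"
  shows "exp_nbr t (\<lambda>n. a * f n + b * g n) n = a * exp_nbr t f n + b * exp_nbr t g n"
proof -
  have "(\<lambda>k. a * (t ^ k / fact k * (nbr_sum ^^ k) f n) + b * (t ^ k / fact k * (nbr_sum ^^ k) g n))
      sums (a * exp_nbr t f n + b * exp_nbr t g n)"
    by (intro sums_add sums_mult exp_nbr_sums assms)
  then show ?thesis
    unfolding exp_nbr_def[of t "\<lambda>n. a * f n + b * g n"] nbr_sum_pow_linear
    by (simp add: algebra_simps sums_iff)
qed

lemma heat_semigroup_linear:
  assumes "exp_bounded f" "exp_bounded g"
  shows "heat_semigroup t (\<lambda>n. a * f n + b * g n) n = a * heat_semigroup t f n + b * heat_semigroup t g n"
  by (simp add: heat_semigroup_eq assms exp_bounded_linear exp_nbr_linear algebra_simps)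

lemma exp_nbr_nbr_sum:
  assumes "exp_bounded f"
  shows "exp_nbr t (nbr_sum f) = nbr_sum (exp_nbr t f)"
proof
  fix n
  have "(\<lambda>k. t ^ k / fact k * (nbr_sum ^^ k) f (n + 1) + t ^ k / fact k * (nbr_sum ^^ k) f (n - 1))
     sums (exp_nbr t f (n + 1) + exp_nbr t f (n - 1))"
    by (intro sums_add exp_nbr_sums assms)
  moreover have "t ^ k / fact k * (nbr_sum ^^ k) f (n + 1) + t ^ k / fact k * (nbr_sum ^^ k) f (n - 1)
      = t ^ k / fact k * (nbr_sum ^^ k) (nbr_sum f) n" for k
    using nbr_sum_def[of "(nbr_sum ^^ k) f" n] funpow_swap1[of nbr_sum k f] by (simp add: algebra_simps)
  ultimately have "(\<lambda>k. t ^ k / fact k * (nbr_sum ^^ k) (nbr_sum f) n)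
     sums (exp_nbr t f (n + 1) + exp_nbr t f (n - 1))"
    by simp
  then show "exp_nbr t (nbr_sum f) n = nbr_sum (exp_nbr t f) n"
    unfolding exp_nbr_def[of t "nbr_sum f"] nbr_sum_def[of "exp_nbr t f"] by (rule sums_unique[symmetric])
qed

lemma exp_nbr_nbr_sum_pow:
  assumes "exp_bounded f"
  shows "exp_nbr t ((nbr_sum ^^ k) f) = (nbr_sum ^^ k) (exp_nbr t f)"
  by (induction k) (simp_all add: exp_nbr_nbr_sum exp_bounded_nbr_sum_pow assms)

lemma heat_semigroup_nbr_sum_pow:
  assumes "exp_bounded f"
  shows "heat_semigroup t ((nbr_sum ^^ k) f) n = (nbr_sum ^^ k) (heat_semigroup t f) n"
proof -
  \<comment> \<open>The zero term allows the linearity of the powers to be used for a scalar multiple.\<close>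
  have "heat_semigroup t f = (\<lambda>n. exp (- 2 * t) * exp_nbr t f n + 0 * exp_nbr t f n)"
    by (rule ext) (simp add: heat_semigroup_eq assms)
  then show ?thesis
    by (simp only: nbr_sum_pow_linear)
       (simp add: heat_semigroup_eq exp_bounded_nbr_sum_pow assms exp_nbr_nbr_sum_pow)
qed

lemma heat_semigroup_lap:
  assumes "exp_bounded f"
  shows "heat_semigroup t (lap f) = lap (heat_semigroup t f)"
  using heat_semigroup_nbr_sum_pow[OF assms, of t 1]
    heat_semigroup_linear[of "nbr_sum f" f t 1 "-2"] exp_bounded_nbr_sum_pow[OF assms, of 1] assms
  by (auto simp: lap_eq fun_eq_iff)

text \<open>For fixed \<open>n\<close> the exponential series is an everywhere convergent power series in \<open>t\<close>, so it may be
differentiated term by term, which shifts its coefficients by one power of the neighbour sum.\<close>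

lemma exp_nbr_has_derivative:
  assumes "exp_bounded f"
  shows "((\<lambda>t. exp_nbr t f n) has_real_derivative exp_nbr t (nbr_sum f) n) (at t)"
proof -
  define c where "c k = (nbr_sum ^^ k) f n / fact k" for k
  have "summable (\<lambda>k. c k * x ^ k)" for x
    using sums_summable[OF exp_nbr_sums[OF assms, of x n]] by (simp add: c_def mult_ac)
  then have "((\<lambda>t. \<Sum>k. c k * t ^ k) has_real_derivative (\<Sum>k. diffs c k * t ^ k)) (at t)"
    by (rule termdiffs_strong_converges_everywhere)
  moreover have "diffs c k * t ^ k = t ^ k / fact k * (nbr_sum ^^ k) (nbr_sum f) n" for k
    by (simp add: diffs_def c_def funpow_swap1)
  ultimately show ?thesis
    by (simp add: exp_nbr_def c_def mult_ac)
qed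

lemma heat_semigroup_has_derivative:
  assumes "exp_bounded f"
  shows "((\<lambda>t. heat_semigroup t f n) has_real_derivative heat_semigroup t (lap f) n) (at t)"
proof -
  have "((\<lambda>t. exp (- 2 * t) * exp_nbr t f n) has_real_derivative
      (exp (- 2 * t) * exp_nbr t (nbr_sum f) n - 2 * exp (- 2 * t) * exp_nbr t f n)) (at t)"
    by (auto intro!: derivative_eq_intros exp_nbr_has_derivative assms)
  moreover have "exp_bounded (nbr_sum f)"
    using exp_bounded_nbr_sum_pow[OF assms, of 1] by simp
  ultimately show ?thesis
    using heat_semigroup_linear[of "nbr_sum f" f t 1 "-2" n] assms
    by (simp add: heat_semigroup_eq lap_eq mult.assoc)
qed

text \<open>The time derivatives in the definition of the Lipschitz classes thus become spatial operators, and
these pass through the Bessel potential by linearity.\<close>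

lemma deriv_heat_semigroup:
  assumes "exp_bounded f"
  shows "(deriv ^^ k) (\<lambda>s. heat_semigroup s f n) t = heat_semigroup t ((lap ^^ k) f) n"
proof -
  have "(deriv ^^ k) (\<lambda>s. heat_semigroup s f n) = (\<lambda>t. heat_semigroup t ((lap ^^ k) f) n)"
    by (induction k)
       (auto intro!: DERIV_imp_deriv heat_semigroup_has_derivative exp_bounded_lap_pow assms)
  then show ?thesis by simp
qed

text \<open>The usual proof of the addition formula for the exponential: the double series summed row by row is
the composition, and summed along antidiagonals it is the series at \<open>s + t\<close>.\<close>

lemma exp_nbr_add:
  assumes "exp_bounded f"
  shows "exp_nbr s (exp_nbr t f) n = exp_nbr (s + t) f n"
proof -
  obtain M where M: "M \<ge> 0" "\<And>k n. \<bar>(nbr_sum ^^ k) f n\<bar> \<le> (5 / 2) ^ k * (M * exp_weight n)"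
    using exp_boundedE[OF assms] by metis
  let ?F = "\<lambda>(j, k). s ^ j / fact j * (t ^ k / fact k * (nbr_sum ^^ k) ((nbr_sum ^^ j) f) n)"
  have s: "?F summable_on UNIV"
  proof (rule abs_summable_summable)
    let ?g = "\<lambda>(p, q). (5 / 2 * \<bar>s\<bar>) ^ p / fact p * ((5 / 2 * \<bar>t\<bar>) ^ q / fact q)"
    have "(\<lambda>pq. ?g pq * (M * exp_weight n)) summable_on UNIV"
      by (intro summable_on_cmult_left summable_exp_product) auto
    then show "(\<lambda>pq. norm (?F pq)) summable_on UNIV"
    proof (rule Infinite_Sum.abs_summable_on_comparison_test', safe)
      fix p q :: nat
      have "\<bar>s\<bar> ^ p / fact p * (\<bar>t\<bar> ^ q / fact q) * \<bar>(nbr_sum ^^ (p + q)) f n\<bar>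
          \<le> \<bar>s\<bar> ^ p / fact p * (\<bar>t\<bar> ^ q / fact q) * ((5 / 2) ^ (p + q) * (M * exp_weight n))"
        by (intro mult_left_mono M) auto
      then show "norm (s ^ p / fact p * (t ^ q / fact q * (nbr_sum ^^ q) ((nbr_sum ^^ p) f) n))
          \<le> (5 / 2 * \<bar>s\<bar>) ^ p / fact p * ((5 / 2 * \<bar>t\<bar>) ^ q / fact q) * (M * exp_weight n)"
        unfolding nbr_sum_pow_add
        by (simp add: abs_mult power_abs power_mult_distrib power_add power_divide mult_ac)
    qed
  qed
  have eq: "(\<Sum>i\<le>k. ?F (i, k - i)) = (s + t) ^ k / fact k * (nbr_sum ^^ k) f n" for k
    unfolding binomial_ring sum_distrib_right sum_divide_distrib
  proof (intro sum.cong refl)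
    fix i assume "i \<in> {..k}"
    then have "real (k choose i) = fact k / (fact i * fact (k - i))"
      "(nbr_sum ^^ (k - i)) ((nbr_sum ^^ i) f) = (nbr_sum ^^ k) f"
      by (auto simp: binomial_fact nbr_sum_pow_add)
    then show "?F (i, k - i) = of_nat (k choose i) * s ^ i * t ^ (k - i) / fact k * (nbr_sum ^^ k) f n"
      by simp
  qed
  have 1: "infsum ?F UNIV = exp_nbr (s + t) f n"
    by (rule sums_unique2[OF sums_diagonal[OF s, unfolded eq] exp_nbr_sums[OF assms]])
  have "((\<lambda>j. s ^ j / fact j * exp_nbr t ((nbr_sum ^^ j) f) n) has_sum infsum ?F UNIV) UNIV"
  proof (rule has_sum_SigmaD)
    show "(?F has_sum infsum ?F UNIV) (UNIV \<times> UNIV)"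
      using has_sum_infsum[OF s] by simp
    fix j :: nat
    have "((\<lambda>k. t ^ k / fact k * (nbr_sum ^^ k) ((nbr_sum ^^ j) f) n) has_sum
       exp_nbr t ((nbr_sum ^^ j) f) n) UNIV"
      by (rule norm_summable_imp_has_sum)
         (simp_all only: real_norm_def exp_nbr_sums exp_nbr_summable exp_bounded_nbr_sum_pow assms)
    then show "((\<lambda>k. ?F (j, k)) has_sum s ^ j / fact j * exp_nbr t ((nbr_sum ^^ j) f) n) UNIV"
      unfolding prod.case by (rule has_sum_cmult_right)
  qed
  then have "(\<lambda>j. s ^ j / fact j * (nbr_sum ^^ j) (exp_nbr t f) n) sums infsum ?F UNIV"
    unfolding exp_nbr_nbr_sum_pow[OF assms] by (rule has_sum_imp_sums)
  then show ?thesis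
    unfolding exp_nbr_def[of s] 1 by (rule sums_unique[symmetric])
qed

lemma heat_semigroup_bound:
  assumes "exp_bounded f"
    and "\<And>n. \<bar>f n\<bar> \<le> w n" and "\<And>n. nbr_sum w n \<le> c * w n" and "c \<ge> 0" and "t \<ge> 0"
  shows "\<bar>heat_semigroup t f n\<bar> \<le> exp ((c - 2) * t) * w n"
proof -
  have "exp (- 2 * t) * \<bar>exp_nbr t f n\<bar> \<le> exp (- 2 * t) * (exp (c * t) * w n)"
    using assms by (intro mult_left_mono exp_nbr_bound) auto
  then show ?thesis
    by (simp add: heat_semigroup_eq assms abs_mult algebra_simps flip: exp_add)
qed

lemma exp_bounded_heat_semigroup:
  assumes "exp_bounded f" "t \<ge> 0"
  shows "exp_bounded (heat_semigroup t f)"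
proof -
  obtain M where M: "\<And>n. \<bar>f n\<bar> \<le> M * exp_weight n"
    using exp_boundedE[OF assms(1)] by metis
  have "\<bar>heat_semigroup t f n\<bar> \<le> exp ((5 / 2 - 2) * t) * (M * exp_weight n)" for n
    by (rule heat_semigroup_bound[OF assms(1) M nbr_sum_scaled_exp_weight]) (use assms in auto)
  then show ?thesis
    unfolding exp_bounded_def by (metis mult.assoc)
qed

lemma heat_semigroup_add:
  assumes "exp_bounded f" "t \<ge> 0"
  shows "heat_semigroup s (heat_semigroup t f) n = heat_semigroup (s + t) f n"
proof -
  have eq: "heat_semigroup t f = (\<lambda>n. exp (- 2 * t) * exp_nbr t f n)"
    by (simp add: heat_semigroup_eq assms fun_eq_iff)
  have "exp_nbr s (\<lambda>n. exp (- 2 * t) * exp_nbr t f n) n = exp (- 2 * t) * exp_nbr s (exp_nbr t f) n"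
  proof -
    have "exp_nbr t f = (\<lambda>n. exp (2 * t) * heat_semigroup t f n + 0 * heat_semigroup t f n)"
      by (auto simp: heat_semigroup_eq assms fun_eq_iff simp flip: exp_add)
    then have "exp_bounded (exp_nbr t f)"
      using exp_bounded_linear[OF exp_bounded_heat_semigroup exp_bounded_heat_semigroup] assms by metis
    from exp_nbr_linear[OF this this, of s "exp (- 2 * t)" 0 n] show ?thesis by simp
  qed
  then have "heat_semigroup s (heat_semigroup t f) n = exp (- 2 * s) * (exp (- 2 * t) * exp_nbr (s + t) f n)"
    using exp_nbr_add[OF assms(1)] exp_bounded_heat_semigroup[OF assms]
    by (simp add: heat_semigroup_eq[OF exp_bounded_heat_semigroup[OF assms]]) (simp add: eq)
  also have "\<dots> = heat_semigroup (s + t) f n"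
    by (simp add: heat_semigroup_eq assms algebra_simps flip: exp_add)
  finally show ?thesis .
qed

lemma exp_weight_ge_pow: "2 ^ nat \<bar>n\<bar> \<le> exp_weight n"
proof (cases "n \<ge> 0")
  case True
  then have "(2::real) powi n = 2 ^ nat \<bar>n\<bar>" by (simp add: power_int_def)
  then show ?thesis by (simp add: exp_weight_def)
next
  case False
  then have "(2::real) powi (- n) = 2 ^ nat \<bar>n\<bar>" by (simp add: power_int_def)
  then show ?thesis by (simp add: exp_weight_def)
qed

lemma exp_weight_ge_1: "exp_weight n \<ge> 1"
  using one_le_power[of "2::real" "nat \<bar>n\<bar>"] exp_weight_ge_pow[of n] by linarith

lemma bounded_imp_exp_bounded:
  assumes "\<And>n. \<bar>f n\<bar> \<le> M"
  shows "exp_bounded f"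
proof -
  have "M \<ge> 0" using assms[of 0] by linarith
  then have "M \<le> M * exp_weight n" for n
    using mult_left_mono[OF exp_weight_ge_1, of M n] by simp
  then show ?thesis
    unfolding exp_bounded_def using assms order_trans by blast
qed

text \<open>Constants are fixed by the semigroup: they are eigenfunctions of the neighbour sum for the value \<open>2\<close>.\<close>

lemma heat_semigroup_contraction:
  assumes "\<And>n. \<bar>f n\<bar> \<le> M" "t \<ge> 0"
  shows "\<bar>heat_semigroup t f n\<bar> \<le> M"
  using heat_semigroup_bound[OF bounded_imp_exp_bounded[OF assms(1)] assms(1), where c = 2 and t = t and n = n] assms
  by (simp add: nbr_sum_def)

section \<open>Smoothing of bounded functions\<close>

definition poisson_weight :: "real \<Rightarrow> nat \<Rightarrow> real" where
  "poisson_weight t p = exp (- t) * (t ^ p / fact p)"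

text \<open>The heat kernel is the law of the difference of two independent Poisson variables with mean \<open>t\<close>.
This operator averages over one of them.\<close>

definition poisson_avg :: "real \<Rightarrow> (int \<Rightarrow> real) \<Rightarrow> int \<Rightarrow> real" where
  "poisson_avg t f n = (\<Sum>p. poisson_weight t p * f (n + int p))"

lemma poisson_weight_nonneg: "t > 0 \<Longrightarrow> poisson_weight t p \<ge> 0"
  by (simp add: poisson_weight_def)

lemma poisson_weight_sums: "poisson_weight t sums 1"
  using sums_mult[OF exp_sums_real[of t], of "exp (- t)"]
  by (simp add: poisson_weight_def[abs_def] flip: exp_add)

lemma poisson_weight_Suc: "real (Suc p) * poisson_weight t (Suc p) = t * poisson_weight t p"
  by (simp del: of_nat_Suc add: poisson_weight_def field_simps)

lemma poisson_variance:
  assumes "t > 0"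
  shows "(\<lambda>p. poisson_weight t p * (real p / t - 1)\<^sup>2) sums (1 / t)"
proof -
  have m1: "(\<lambda>p. real p * poisson_weight t p) sums t"
  proof -
    have "(\<lambda>p. real (Suc p) * poisson_weight t (Suc p)) sums (t * 1)"
      unfolding poisson_weight_Suc by (intro sums_mult poisson_weight_sums)
    from sums_Suc[where f = "\<lambda>p. real p * poisson_weight t p", OF this] show ?thesis by simp
  qed
  \<comment> \<open>A second shift of the index reduces the second moment to the mean and the total mass.\<close>
  have m2: "(\<lambda>p. (real p)\<^sup>2 * poisson_weight t p) sums (t * (t + 1))"
  proof -
    have "(\<lambda>p. t * (real p * poisson_weight t p + poisson_weight t p)) sums (t * (t + 1))"
      by (intro sums_mult sums_add m1 poisson_weight_sums)
    moreover have "t * (real p * poisson_weight t p + poisson_weight t p) = (real (Suc p))\<^sup>2 * poisson_weight t (Suc p)" for p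
    proof -
      have "(real (Suc p))\<^sup>2 * poisson_weight t (Suc p) = real (Suc p) * (real (Suc p) * poisson_weight t (Suc p))"
        by (simp only: power2_eq_square mult.assoc)
      also have "\<dots> = t * (real p * poisson_weight t p + poisson_weight t p)"
        unfolding poisson_weight_Suc by (simp add: algebra_simps)
      finally show ?thesis by simp
    qed
    ultimately have "(\<lambda>p. (real (Suc p))\<^sup>2 * poisson_weight t (Suc p)) sums (t * (t + 1))"
      by (simp only:)
    from sums_Suc[where f = "\<lambda>p. (real p)\<^sup>2 * poisson_weight t p", OF this]
    show ?thesis by simp
  qed
  have "(\<lambda>p. 1 / t\<^sup>2 * ((real p)\<^sup>2 * poisson_weight t p) - 2 / t * (real p * poisson_weight t p) + poisson_weight t p) sums
      (1 / t\<^sup>2 * (t * (t + 1)) - 2 / t * t + 1)"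
    by (intro sums_add sums_diff sums_mult m1 m2 poisson_weight_sums)
  also have "(\<lambda>p. 1 / t\<^sup>2 * ((real p)\<^sup>2 * poisson_weight t p) - 2 / t * (real p * poisson_weight t p) + poisson_weight t p) =
      (\<lambda>p. poisson_weight t p * (real p / t - 1)\<^sup>2)"
    by (rule ext) (simp add: power2_diff power_divide ring_distribs mult.commute)
  also have "1 / t\<^sup>2 * (t * (t + 1)) - 2 / t * t + 1 = 1 / t"
    using assms by (simp add: power2_eq_square add_divide_distrib)
  finally show ?thesis .
qed

lemma poisson_avg_summable:
  assumes "\<And>n. \<bar>f n\<bar> \<le> M" "t > 0"
  shows "summable (\<lambda>p. \<bar>poisson_weight t p * f (n + int p)\<bar>)"
proof (rule summable_comparison_test'[where N = 0])
  show "summable (\<lambda>p. poisson_weight t p * M)"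
    by (intro summable_mult2 sums_summable[OF poisson_weight_sums])
  show "norm \<bar>poisson_weight t p * f (n + int p)\<bar> \<le> poisson_weight t p * M" for p
    using assms mult_left_mono[OF assms(1)[of "n + int p"], of "poisson_weight t p"] poisson_weight_nonneg[of t p]
    by (simp add: abs_mult)
qed

lemma poisson_avg_sums:
  assumes "\<And>n. \<bar>f n\<bar> \<le> M" "t > 0"
  shows "(\<lambda>p. poisson_weight t p * f (n + int p)) sums poisson_avg t f n"
  unfolding poisson_avg_def
  by (rule summable_sums[OF summable_rabs_cancel[OF poisson_avg_summable[OF assms]]])

text \<open>Shifting the argument by one shifts the Poisson weights, and the difference of consecutive weights is
the weight at \<open>p\<close> times \<open>p / t - 1\<close>. So the estimate is a bound for the mean absolute deviation of a
Poisson variable by its standard deviation.\<close>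

lemma poisson_avg_diff:
  assumes f: "\<And>n. \<bar>f n\<bar> \<le> M" and t: "t > 0"
  shows "\<bar>poisson_avg t f (n + 1) - poisson_avg t f n\<bar> \<le> M / sqrt t"
proof -
  have "(\<lambda>p. poisson_weight t p * f (n + 1 + int p)) sums poisson_avg t f (n + 1)"
    by (rule poisson_avg_sums[OF assms])
  moreover have "poisson_weight t p * f (n + 1 + int p) = real (Suc p) / t * poisson_weight t (Suc p) * f (n + int (Suc p))" for p
  proof -
    have "real (Suc p) / t * poisson_weight t (Suc p) = poisson_weight t p"
      using poisson_weight_Suc[of p t] t by (simp only: times_divide_eq_left) simp
    then show ?thesis by (simp add: add_ac)
  qed
  ultimately have "(\<lambda>p. real (Suc p) / t * poisson_weight t (Suc p) * f (n + int (Suc p))) sums poisson_avg t f (n + 1)"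
    by (simp only:)
  from sums_Suc[OF this]
  have "(\<lambda>p. real p / t * poisson_weight t p * f (n + int p)) sums poisson_avg t f (n + 1)"
    by simp
  from sums_diff[OF this poisson_avg_sums[OF assms, where n = n]]
  have d: "(\<lambda>p. poisson_weight t p * ((real p / t - 1) * f (n + int p))) sums (poisson_avg t f (n + 1) - poisson_avg t f n)"
    by (simp add: algebra_simps)
  have "(\<lambda>p. (poisson_weight t p * (1 / sqrt t) + sqrt t * (poisson_weight t p * (real p / t - 1)\<^sup>2)) * (M / 2)) sums
      ((1 * (1 / sqrt t) + sqrt t * (1 / t)) * (M / 2))"
    by (intro sums_mult sums_mult2 sums_add poisson_weight_sums poisson_variance t)
  also have "sqrt t * (1 / t) = 1 / sqrt t"
    using t real_div_sqrt[of t] by (simp add: field_simps)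
  finally have s: "(\<lambda>p. (poisson_weight t p * (1 / sqrt t) + sqrt t * (poisson_weight t p * (real p / t - 1)\<^sup>2)) * (M / 2)) sums (M / sqrt t)"
    by simp
  have le: "\<bar>poisson_weight t p * ((real p / t - 1) * f (n + int p))\<bar>
      \<le> (poisson_weight t p * (1 / sqrt t) + sqrt t * (poisson_weight t p * (real p / t - 1)\<^sup>2)) * (M / 2)" for p
  proof -
    let ?x = "real p / t - 1"
    \<comment> \<open>Young's inequality with the parameter \<open>sqrt t\<close> balances mass \<open>1\<close> against variance \<open>1 / t\<close>; it replaces the Cauchy-Schwarz inequality for series.\<close>
    have "0 \<le> (1 - sqrt t * \<bar>?x\<bar>)\<^sup>2 / sqrt t"
      using t by simp
    also have "\<dots> = 1 / sqrt t + sqrt t * ?x\<^sup>2 - 2 * \<bar>?x\<bar>"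
    proof -
      have "(1 - sqrt t * \<bar>?x\<bar>)\<^sup>2 = 1 - 2 * sqrt t * \<bar>?x\<bar> + sqrt t * (sqrt t * ?x\<^sup>2)"
        by (simp add: power2_diff power_mult_distrib power2_eq_square[of "sqrt t"])
      then show ?thesis using t by (simp add: diff_divide_distrib add_divide_distrib)
    qed
    finally have x: "\<bar>?x\<bar> \<le> (1 / sqrt t + sqrt t * ?x\<^sup>2) / 2" by simp
    have "\<bar>?x\<bar> * \<bar>f (n + int p)\<bar> \<le> (1 / sqrt t + sqrt t * ?x\<^sup>2) / 2 * M"
      using t by (intro mult_mono x f) auto
    then have "poisson_weight t p * (\<bar>?x\<bar> * \<bar>f (n + int p)\<bar>) \<le> poisson_weight t p * ((1 / sqrt t + sqrt t * ?x\<^sup>2) / 2 * M)"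
      using t by (intro mult_left_mono poisson_weight_nonneg) auto
    also have "poisson_weight t p * (\<bar>?x\<bar> * \<bar>f (n + int p)\<bar>) = \<bar>poisson_weight t p * (?x * f (n + int p))\<bar>"
      by (simp only: abs_mult abs_of_nonneg[OF poisson_weight_nonneg[OF t]])
    finally show ?thesis
      by (simp add: algebra_simps)
  qed
  have sa: "summable (\<lambda>p. \<bar>poisson_weight t p * ((real p / t - 1) * f (n + int p))\<bar>)"
    by (rule summable_comparison_test'[OF sums_summable[OF s], of 0]) (use le in auto)
  have "\<bar>poisson_avg t f (n + 1) - poisson_avg t f n\<bar> \<le> (\<Sum>p. \<bar>poisson_weight t p * ((real p / t - 1) * f (n + int p))\<bar>)"
    using summable_rabs[OF sa] sums_unique[OF d] by simp
  also have "\<dots> \<le> M / sqrt t"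
    using suminf_le[OF le sa sums_summable[OF s]] sums_unique[OF s] by simp
  finally show ?thesis .
qed

lemma poisson_avg_bound:
  assumes "\<And>n. \<bar>f n\<bar> \<le> M" "t > 0"
  shows "\<bar>poisson_avg t f n\<bar> \<le> M"
proof -
  have "\<bar>poisson_avg t f n\<bar> \<le> (\<Sum>p. \<bar>poisson_weight t p * f (n + int p)\<bar>)"
    unfolding poisson_avg_def by (rule summable_rabs[OF poisson_avg_summable[OF assms]])
  also have "\<dots> \<le> (\<Sum>p. poisson_weight t p * M)"
  proof (rule suminf_le)
    show "summable (\<lambda>p. \<bar>poisson_weight t p * f (n + int p)\<bar>)"
      by (rule poisson_avg_summable[OF assms])
    show "\<bar>poisson_weight t p * f (n + int p)\<bar> \<le> poisson_weight t p * M" for p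
      using assms mult_left_mono[OF assms(1)[of "n + int p"], of "poisson_weight t p"] poisson_weight_nonneg[of t p]
      by (simp add: abs_mult)
    show "summable (\<lambda>p. poisson_weight t p * M)"
      by (intro summable_mult2 sums_summable[OF poisson_weight_sums])
  qed
  also have "\<dots> = M"
    using sums_unique[OF sums_mult2[OF poisson_weight_sums[of t], of M]] by simp
  finally show ?thesis .
qed

lemma heat_semigroup_eq_poisson_avg:
  assumes f: "\<And>n. \<bar>f n\<bar> \<le> M" and t: "t > 0"
  shows "heat_semigroup t f n = poisson_avg t (\<lambda>m. poisson_avg t (\<lambda>k. f (- k)) (- m)) n"
proof -
  let ?B = "\<lambda>m. poisson_avg t (\<lambda>k. f (- k)) (- m)"
  let ?F = "\<lambda>(p, q). t ^ p / fact p * (t ^ q / fact q) * f (n + int p - int q)"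
  have f': "\<bar>f (- k)\<bar> \<le> M" for k by (rule f)
  have "(?F has_sum exp_nbr t f n) (UNIV \<times> UNIV)"
    using double_sum_eq_exp_nbr[OF bounded_imp_exp_bounded[OF f], where t = t and n = n] by simp
  then have "((\<lambda>p. t ^ p / fact p * (exp t * ?B (n + int p))) has_sum exp_nbr t f n) UNIV"
  proof (rule has_sum_SigmaD)
    fix p :: nat
    have B: "(\<lambda>q. poisson_weight t q * f (- (- (n + int p) + int q))) sums ?B (n + int p)"
      by (rule poisson_avg_sums[of "\<lambda>k. f (- k)", OF f' t])
    have "((\<lambda>q. poisson_weight t q * f (- (- (n + int p) + int q))) has_sum ?B (n + int p)) UNIV"
      by (rule norm_summable_imp_has_sum[OF _ B])
         (use poisson_avg_summable[of "\<lambda>k. f (- k)", OF f' t] in \<open>simp only: real_norm_def\<close>)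
    then have "((\<lambda>q. t ^ p / fact p * (exp t * (poisson_weight t q * f (- (- (n + int p) + int q))))) has_sum
      t ^ p / fact p * (exp t * ?B (n + int p))) UNIV"
      by (intro has_sum_cmult_right)
    moreover have "t ^ p / fact p * (exp t * (poisson_weight t q * f (- (- (n + int p) + int q)))) = ?F (p, q)" for q
      by (simp add: poisson_weight_def exp_minus add.commute[of "int p"])
    ultimately show "((\<lambda>q. ?F (p, q)) has_sum t ^ p / fact p * (exp t * ?B (n + int p))) UNIV"
      by (simp only:)
  qed
  then have "(\<lambda>p. t ^ p / fact p * (exp t * ?B (n + int p))) sums exp_nbr t f n"
    by (rule has_sum_imp_sums)
  then have "(\<lambda>p. exp (- 2 * t) * (t ^ p / fact p * (exp t * ?B (n + int p)))) sums heat_semigroup t f n"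
    unfolding heat_semigroup_eq[OF bounded_imp_exp_bounded[OF f]] by (rule sums_mult)
  moreover have "exp (- 2 * t) * (t ^ p / fact p * (exp t * ?B (n + int p))) = poisson_weight t p * ?B (n + int p)" for p
  proof -
    have "exp (- t) = exp (- 2 * t) * exp t" by (simp flip: exp_add)
    then show ?thesis by (simp add: poisson_weight_def)
  qed
  ultimately have "(\<lambda>p. poisson_weight t p * ?B (n + int p)) sums heat_semigroup t f n"
    by (simp only:)
  then show ?thesis
    unfolding poisson_avg_def[of t ?B] by (rule sums_unique)
qed

text \<open>The Laplacian is, up to sign, the product of the forward and the backward difference, and the heat
semigroup is the product of the Poisson averages in the two directions. Each average gains
\<open>1 / sqrt t\<close> from the difference in its own direction.\<close>

lemma heat_semigroup_lap_bound:
  assumes f: "\<And>n. \<bar>f n\<bar> \<le> M" and t: "t > 0"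
  shows "\<bar>heat_semigroup t (lap f) n\<bar> \<le> M / t"
proof -
  define B where "B m = poisson_avg t (\<lambda>k. f (- k)) (- m)" for m
  \<comment> \<open>The difference in the backward variable, already small, is the function that is averaged in the forward variable.\<close>
  define D where "D m = B (m + 1) - B m" for m
  have f': "\<bar>f (- k)\<bar> \<le> M" for k by (rule f)
  have D: "\<bar>D m\<bar> \<le> M / sqrt t" for m
    using poisson_avg_diff[of "\<lambda>k. f (- k)", OF f' t, where n = "- m - 1"]
    by (simp add: D_def B_def abs_minus_commute)
  have B: "\<bar>B m\<bar> \<le> M" for m
    unfolding B_def by (rule poisson_avg_bound[of "\<lambda>k. f (- k)", OF f' t])
  have avg_D: "poisson_avg t B (m + 1) - poisson_avg t B m = poisson_avg t D m" for m
  proof -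
    have "poisson_weight t p * B (m + 1 + int p) - poisson_weight t p * B (m + int p)
        = poisson_weight t p * D (m + int p)" for p
      by (simp add: D_def algebra_simps)
    with sums_diff[OF poisson_avg_sums[where f = B, OF B t, where n = "m + 1"] poisson_avg_sums[where f = B, OF B t, where n = m]]
    have "(\<lambda>p. poisson_weight t p * D (m + int p)) sums (poisson_avg t B (m + 1) - poisson_avg t B m)"
      by (simp only:)
    then show ?thesis
      by (rule sums_unique2[OF _ poisson_avg_sums[where f = D, OF D t]])
  qed
  have "heat_semigroup t (lap f) n = lap (heat_semigroup t f) n"
    by (simp add: heat_semigroup_lap bounded_imp_exp_bounded[OF f])
  also have "heat_semigroup t f = poisson_avg t B"
    unfolding B_def by (rule ext, rule heat_semigroup_eq_poisson_avg[where f = f, OF f t])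
  also have "lap (poisson_avg t B) n = poisson_avg t D (n - 1 + 1) - poisson_avg t D (n - 1)"
    using avg_D[of n] avg_D[of "n - 1"] by (simp add: lap_def)
  also have "\<bar>\<dots>\<bar> \<le> M / sqrt t / sqrt t"
    by (rule poisson_avg_diff[OF D t])
  finally show ?thesis using t by simp
qed

section \<open>Averages against the gamma kernel\<close>

text \<open>The Bessel potential separates into the heat flow and this averaging in time, so that the interchange
of integral, sum and operator can be proved for general integrands.\<close>

definition gamma_avg :: "real \<Rightarrow> (real \<Rightarrow> real) \<Rightarrow> real" where
  "gamma_avg b F = 1 / Gamma b * (LINT \<tau>:{0<..}|lborel. exp (- \<tau>) * F \<tau> * \<tau> powr b / \<tau>)"

lemma bessel_potential_eq: "bessel_potential \<beta> f n = gamma_avg (\<beta> / 2) (\<lambda>\<tau>. heat_semigroup \<tau> f n)"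
  by (simp add: bessel_potential_def gamma_avg_def)

lemma set_integrable_lborel_nonneg:
  fixes f :: "real \<Rightarrow> real"
  assumes "f \<in> borel_measurable borel" "S \<in> sets borel" "f integrable_on S" "\<And>x. x \<in> S \<Longrightarrow> f x \<ge> 0"
  shows "set_integrable lborel S f"
proof -
  have "set_integrable lebesgue S f"
    by (rule nonnegative_absolutely_integrable_1) (use assms in auto)
  then show ?thesis
    using assms(1,2) by (simp add: set_integrable_def integrable_completion)
qed

lemma gamma_kernel_integrable:
  fixes b :: real
  assumes "b > 0"
  shows "set_integrable lborel {0<..} (\<lambda>\<tau>. exp (- \<tau>) * exp (\<tau> / 2) * \<tau> powr b / \<tau>)"
proof -
  let ?g = "\<lambda>t. complex_of_real t powr (of_real b - 1) / of_real (exp (1 / 2 * t))"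
  have "?g absolutely_integrable_on {0<..}"
    by (rule absolutely_integrable_Gamma_integral) (use assms in auto)
  then have "(\<lambda>t. norm (?g t)) integrable_on {0<..}"
    by (rule set_lebesgue_integral_eq_integral(1)[OF set_integrable_norm])
  also have "?this \<longleftrightarrow> (\<lambda>\<tau>. exp (- \<tau>) * exp (\<tau> / 2) * \<tau> powr b / \<tau>) integrable_on {0<..}"
  proof (rule integrable_cong)
    fix t :: real assume t: "t \<in> {0<..}"
    have "exp (- t) * exp (t / 2) = 1 / exp (1 / 2 * t)"
      by (simp add: field_simps flip: exp_add exp_minus)
    moreover have "t powr (b - 1) = t powr b / t"
      using t by (simp add: powr_diff)
    moreover have "norm (complex_of_real t powr (of_real b - 1)) = t powr (b - 1)"
      using t by (simp add: norm_powr_real_powr)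
    ultimately show "norm (?g t) = exp (- t) * exp (t / 2) * t powr b / t"
      by (simp add: norm_divide)
  qed
  finally show ?thesis
    by (intro set_integrable_lborel_nonneg) auto
qed

lemma gamma_avg_integrand_bound:
  fixes x :: real
  assumes "\<bar>x\<bar> \<le> K * exp (\<tau> / 2)" "\<tau> > 0"
  shows "\<bar>exp (- \<tau>) * x * \<tau> powr b / \<tau>\<bar> \<le> K * (exp (- \<tau>) * exp (\<tau> / 2) * \<tau> powr b / \<tau>)"
proof -
  have "exp (- \<tau>) * \<tau> powr b / \<tau> * \<bar>x\<bar> \<le> exp (- \<tau>) * \<tau> powr b / \<tau> * (K * exp (\<tau> / 2))"
    using assms by (intro mult_left_mono) auto
  then show ?thesis
    using assms(2) by (simp add: abs_mult mult_ac)
qed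

lemma gamma_avg_integrable:
  fixes F :: "real \<Rightarrow> real"
  assumes b: "b > 0" and F: "F \<in> borel_measurable borel" "\<And>\<tau>. \<tau> > 0 \<Longrightarrow> \<bar>F \<tau>\<bar> \<le> K * exp (\<tau> / 2)"
  shows "set_integrable lborel {0<..} (\<lambda>\<tau>. exp (- \<tau>) * F \<tau> * \<tau> powr b / \<tau>)"
proof (rule set_integrable_bound)
  show "set_integrable lborel {0<..} (\<lambda>\<tau>. K * (exp (- \<tau>) * exp (\<tau> / 2) * \<tau> powr b / \<tau>))"
    by (rule set_integrable_mult_right[OF gamma_kernel_integrable[OF b]])
  show "set_borel_measurable lborel {0<..} (\<lambda>\<tau>. exp (- \<tau>) * F \<tau> * \<tau> powr b / \<tau>)"
    unfolding set_borel_measurable_def using F by measurable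
  show "AE \<tau> in lborel. \<tau> \<in> {0<..} \<longrightarrow> norm (exp (- \<tau>) * F \<tau> * \<tau> powr b / \<tau>)
      \<le> norm (K * (exp (- \<tau>) * exp (\<tau> / 2) * \<tau> powr b / \<tau>))"
    unfolding real_norm_def
    by (intro AE_I2 impI order_trans[OF gamma_avg_integrand_bound[OF F(2)] abs_ge_self]) auto
qed

lemma gamma_avg_dominated:
  assumes b: "b > 0"
    and f: "set_integrable lborel {0<..} (\<lambda>\<tau>. exp (- \<tau>) * F \<tau> * \<tau> powr b / \<tau>)"
    and g: "set_integrable lborel {0<..} g"
    and le: "\<And>\<tau>. \<tau> > 0 \<Longrightarrow> \<bar>exp (- \<tau>) * F \<tau> * \<tau> powr b / \<tau>\<bar> \<le> g \<tau>"
  shows "\<bar>gamma_avg b F\<bar> \<le> 1 / Gamma b * (LINT \<tau>:{0<..}|lborel. g \<tau>)"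
proof -
  have "\<bar>LINT \<tau>:{0<..}|lborel. exp (- \<tau>) * F \<tau> * \<tau> powr b / \<tau>\<bar>
      \<le> (LINT \<tau>:{0<..}|lborel. norm (exp (- \<tau>) * F \<tau> * \<tau> powr b / \<tau>))"
    using set_integral_norm_bound[OF f] by simp
  also have "\<dots> \<le> (LINT \<tau>:{0<..}|lborel. g \<tau>)"
    by (rule set_integral_mono[OF set_integrable_norm[OF f] g]) (use le in auto)
  finally show ?thesis
    using Gamma_real_pos[OF b] by (simp add: gamma_avg_def abs_mult divide_right_mono)
qed

lemma gamma_avg_bound:
  assumes b: "b > 0" and F: "F \<in> borel_measurable borel" "\<And>\<tau>. \<tau> > 0 \<Longrightarrow> \<bar>F \<tau>\<bar> \<le> K * exp (\<tau> / 2)"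
  shows "\<bar>gamma_avg b F\<bar> \<le> K * gamma_avg b (\<lambda>\<tau>. exp (\<tau> / 2))"
proof -
  have "\<bar>gamma_avg b F\<bar> \<le> 1 / Gamma b * (LINT \<tau>:{0<..}|lborel. K * (exp (- \<tau>) * exp (\<tau> / 2) * \<tau> powr b / \<tau>))"
    by (rule gamma_avg_dominated[OF b gamma_avg_integrable[OF assms]
          set_integrable_mult_right[OF gamma_kernel_integrable[OF b]]])
       (use gamma_avg_integrand_bound F in auto)
  then show ?thesis
    unfolding set_integral_mult_right by (simp add: gamma_avg_def)
qed

lemma gamma_avg_linear:
  assumes b: "b > 0"
    and F: "F \<in> borel_measurable borel" "\<And>\<tau>. \<tau> > 0 \<Longrightarrow> \<bar>F \<tau>\<bar> \<le> K * exp (\<tau> / 2)"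
    and G: "G \<in> borel_measurable borel" "\<And>\<tau>. \<tau> > 0 \<Longrightarrow> \<bar>G \<tau>\<bar> \<le> L * exp (\<tau> / 2)"
  shows "gamma_avg b (\<lambda>\<tau>. x * F \<tau> + y * G \<tau>) = x * gamma_avg b F + y * gamma_avg b G"
proof -
  note f = gamma_avg_integrable[OF b F] and g = gamma_avg_integrable[OF b G]
  have "(LINT \<tau>:{0<..}|lborel. x * (exp (- \<tau>) * F \<tau> * \<tau> powr b / \<tau>) + y * (exp (- \<tau>) * G \<tau> * \<tau> powr b / \<tau>))
      = x * (LINT \<tau>:{0<..}|lborel. exp (- \<tau>) * F \<tau> * \<tau> powr b / \<tau>)
        + y * (LINT \<tau>:{0<..}|lborel. exp (- \<tau>) * G \<tau> * \<tau> powr b / \<tau>)"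
    by (subst set_integral_add) (use f g in \<open>auto intro!: set_integrable_mult_right simp del: times_divide_eq_right\<close>)
  moreover have "x * (exp (- \<tau>) * F \<tau> * \<tau> powr b / \<tau>) + y * (exp (- \<tau>) * G \<tau> * \<tau> powr b / \<tau>)
      = exp (- \<tau>) * (x * F \<tau> + y * G \<tau>) * \<tau> powr b / \<tau>" for \<tau>
    by (simp add: algebra_simps add_divide_distrib)
  ultimately show ?thesis
    by (simp add: gamma_avg_def algebra_simps add_divide_distrib)
qed

text \<open>Fubini's theorem for the gamma average and a series in the space variable, under the domination that
exponentially bounded functions satisfy.\<close>

lemma gamma_avg_series:
  assumes b: "b > 0" and F: "\<And>k. F k \<in> borel_measurable borel"
    and le: "\<And>k \<tau>. \<tau> > 0 \<Longrightarrow> \<bar>F k \<tau>\<bar> \<le> K k * exp (\<tau> / 2)" and K: "summable K"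
  shows "(\<lambda>k. gamma_avg b (F k)) sums gamma_avg b (\<lambda>\<tau>. \<Sum>k. F k \<tau>)"
proof -
  let ?e = "\<lambda>\<tau>. exp (- \<tau>) * exp (\<tau> / 2) * \<tau> powr b / \<tau>"
  let ?f = "\<lambda>k \<tau>. exp (- \<tau>) * F k \<tau> * \<tau> powr b / \<tau>"
  let ?g = "\<lambda>k \<tau>. indicator {0<..} \<tau> *\<^sub>R ?f k \<tau>"
  have int: "set_integrable lborel {0<..} (?f k)" for k
    by (rule gamma_avg_integrable[OF b F le])
  have sum_F: "summable (\<lambda>k. \<bar>F k \<tau>\<bar>)" if "\<tau> > 0" for \<tau>
    by (rule summable_comparison_test'[OF summable_mult2[OF K, of "exp (\<tau> / 2)"], of 0])
       (use le that in auto)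
  have ae: "AE \<tau> in lborel. summable (\<lambda>k. norm (?g k \<tau>))"
  proof (rule AE_I2)
    fix \<tau> :: real
    show "summable (\<lambda>k. norm (?g k \<tau>))"
    proof (cases "\<tau> > 0")
      case True
      have "summable (\<lambda>k. exp (- \<tau>) * \<bar>F k \<tau>\<bar> * (\<tau> powr b / \<tau>))"
        by (intro summable_mult summable_mult2 sum_F True)
      then show ?thesis using True by (simp add: abs_mult)
    qed simp
  qed
  have summ: "summable (\<lambda>k. LINT \<tau>|lborel. norm (?g k \<tau>))"
  proof (rule summable_comparison_test'[where N = 0])
    show "summable (\<lambda>k. K k * (LINT \<tau>:{0<..}|lborel. ?e \<tau>))"
      by (rule summable_mult2[OF K])
    fix k :: nat
    have "(LINT \<tau>|lborel. norm (?g k \<tau>)) = (LINT \<tau>:{0<..}|lborel. norm (?f k \<tau>))"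
      unfolding set_lebesgue_integral_def
      by (intro Bochner_Integration.integral_cong refl) (auto simp: indicator_def)
    also have "\<dots> \<le> (LINT \<tau>:{0<..}|lborel. K k * ?e \<tau>)"
      by (rule set_integral_mono[OF set_integrable_norm[OF int]
            set_integrable_mult_right[OF gamma_kernel_integrable[OF b]]])
         (use gamma_avg_integrand_bound le in auto)
    finally have "(LINT \<tau>|lborel. norm (?g k \<tau>)) \<le> K k * (LINT \<tau>:{0<..}|lborel. ?e \<tau>)"
      unfolding set_integral_mult_right .
    moreover have "(LINT \<tau>|lborel. norm (?g k \<tau>)) \<ge> 0"
      by (rule integral_nonneg_AE) auto
    ultimately show "norm (LINT \<tau>|lborel. norm (?g k \<tau>)) \<le> K k * (LINT \<tau>:{0<..}|lborel. ?e \<tau>)"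
      by (simp only: real_norm_def abs_of_nonneg)
  qed
  have "(\<lambda>k. integral\<^sup>L lborel (?g k)) sums (LINT \<tau>|lborel. (\<Sum>k. ?g k \<tau>))"
    by (rule sums_integral[OF _ ae summ]) (use int in \<open>simp add: set_integrable_def\<close>)
  also have "(LINT \<tau>|lborel. (\<Sum>k. ?g k \<tau>)) = (LINT \<tau>:{0<..}|lborel. exp (- \<tau>) * (\<Sum>k. F k \<tau>) * \<tau> powr b / \<tau>)"
    unfolding set_lebesgue_integral_def
  proof (rule Bochner_Integration.integral_cong)
    fix \<tau> :: real
    show "(\<Sum>k. ?g k \<tau>) = indicator {0<..} \<tau> *\<^sub>R (exp (- \<tau>) * (\<Sum>k. F k \<tau>) * \<tau> powr b / \<tau>)"
    proof (cases "\<tau> > 0")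
      case True
      have "(\<lambda>k. exp (- \<tau>) * F k \<tau> * (\<tau> powr b / \<tau>)) sums (exp (- \<tau>) * (\<Sum>k. F k \<tau>) * (\<tau> powr b / \<tau>))"
        by (intro sums_mult sums_mult2 summable_sums summable_rabs_cancel[OF sum_F[OF True]])
      then show ?thesis using True by (simp add: sums_iff)
    qed simp
  qed simp
  finally show ?thesis
    unfolding gamma_avg_def set_lebesgue_integral_def by (rule sums_mult)
qed

section \<open>The Bessel potential commutes with the heat flow\<close>

lemma heat_semigroup_measurable:
  assumes "exp_bounded f"
  shows "(\<lambda>\<tau>. heat_semigroup (t + \<tau>) f n) \<in> borel_measurable borel"
proof (rule borel_measurable_continuous_onI, rule continuous_at_imp_continuous_on, safe)
  fix \<tau> :: real
  have "isCont (\<lambda>s. heat_semigroup s f n) (t + \<tau>)"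
    by (rule DERIV_isCont[OF heat_semigroup_has_derivative[OF assms]])
  then show "isCont (\<lambda>\<tau>. heat_semigroup (t + \<tau>) f n) \<tau>"
    by (intro isCont_o2[where f = "\<lambda>\<tau>. t + \<tau>" and g = "\<lambda>s. heat_semigroup s f n"]) auto
qed

lemma heat_semigroup_measurable_0:
  assumes "exp_bounded f"
  shows "(\<lambda>\<tau>. heat_semigroup \<tau> f n) \<in> borel_measurable borel"
  using heat_semigroup_measurable[OF assms, of 0] by simp

lemma heat_semigroup_growth:
  assumes "exp_bounded f" "\<And>n. \<bar>f n\<bar> \<le> M * exp_weight n" "\<tau> > 0"
  shows "\<bar>heat_semigroup \<tau> f n\<bar> \<le> M * exp_weight n * exp (\<tau> / 2)"
  using heat_semigroup_bound[OF assms(1,2) nbr_sum_scaled_exp_weight, where t = \<tau> and n = n] assms(3)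
  by (simp add: mult_ac)

lemma exp_boundedE_heat:
  assumes "exp_bounded f"
  obtains K where "\<And>\<tau>. \<tau> > 0 \<Longrightarrow> \<bar>heat_semigroup \<tau> f n\<bar> \<le> K * exp (\<tau> / 2)"
  using heat_semigroup_growth[OF assms] exp_boundedE[OF assms] by metis

context
  fixes \<beta> :: real
  assumes \<beta>: "\<beta> > 0"
begin

lemma half_pos: "\<beta> / 2 > 0" using \<beta> by simp

lemma bessel_potential_linear:
  assumes "exp_bounded f" "exp_bounded g"
  shows "bessel_potential \<beta> (\<lambda>n. x * f n + y * g n) n = x * bessel_potential \<beta> f n + y * bessel_potential \<beta> g n"
proof -
  obtain K where K: "\<And>\<tau>. \<tau> > 0 \<Longrightarrow> \<bar>heat_semigroup \<tau> f n\<bar> \<le> K * exp (\<tau> / 2)"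
    using exp_boundedE_heat[OF assms(1)] by metis
  obtain L where L: "\<And>\<tau>. \<tau> > 0 \<Longrightarrow> \<bar>heat_semigroup \<tau> g n\<bar> \<le> L * exp (\<tau> / 2)"
    using exp_boundedE_heat[OF assms(2)] by metis
  show ?thesis
    unfolding bessel_potential_eq heat_semigroup_linear[OF assms]
    by (rule gamma_avg_linear[OF half_pos heat_semigroup_measurable_0[OF assms(1)] K
          heat_semigroup_measurable_0[OF assms(2)] L])
qed

text \<open>The neighbour sum is a finite combination of translations, with which the heat flow and hence the
potential commute.\<close>

lemma bessel_potential_nbr_sum:
  assumes "exp_bounded f"
  shows "bessel_potential \<beta> (nbr_sum f) = nbr_sum (bessel_potential \<beta> f)"
proof
  fix n
  have eq: "heat_semigroup \<tau> (nbr_sum f) n = 1 * heat_semigroup \<tau> f (n + 1) + 1 * heat_semigroup \<tau> f (n - 1)" for \<tau>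
    using heat_semigroup_nbr_sum_pow[OF assms, of \<tau> 1 n] by (simp add: nbr_sum_def)
  obtain K where K: "\<And>\<tau>. \<tau> > 0 \<Longrightarrow> \<bar>heat_semigroup \<tau> f (n + 1)\<bar> \<le> K * exp (\<tau> / 2)"
    using exp_boundedE_heat[OF assms(1)] by metis
  obtain L where L: "\<And>\<tau>. \<tau> > 0 \<Longrightarrow> \<bar>heat_semigroup \<tau> f (n - 1)\<bar> \<le> L * exp (\<tau> / 2)"
    using exp_boundedE_heat[OF assms(1)] by metis
  show "bessel_potential \<beta> (nbr_sum f) n = nbr_sum (bessel_potential \<beta> f) n"
    unfolding nbr_sum_def[of "bessel_potential \<beta> f"] bessel_potential_eq eq
    by (subst gamma_avg_linear[OF half_pos heat_semigroup_measurable_0[OF assms(1)] K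
          heat_semigroup_measurable_0[OF assms(1)] L]) auto
qed

lemma bessel_potential_nbr_sum_pow:
  assumes "exp_bounded f"
  shows "bessel_potential \<beta> ((nbr_sum ^^ k) f) = (nbr_sum ^^ k) (bessel_potential \<beta> f)"
  by (induction k) (simp_all add: bessel_potential_nbr_sum exp_bounded_nbr_sum_pow assms)

lemma bessel_potential_lap_pow:
  assumes "exp_bounded f"
  shows "bessel_potential \<beta> ((lap ^^ k) f) = (lap ^^ k) (bessel_potential \<beta> f)"
proof (induction k)
  case (Suc k)
  have "bessel_potential \<beta> (lap g) = lap (bessel_potential \<beta> g)" if g: "exp_bounded g" for g
    using bessel_potential_linear[OF exp_bounded_nbr_sum_pow[OF g, of 1] g, of 1 "-2"]
      bessel_potential_nbr_sum[OF g]
    by (auto simp: lap_eq)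
  from this[OF exp_bounded_lap_pow[OF assms, of k]] Suc show ?case by simp
qed simp

lemma exp_bounded_bessel_potential:
  assumes "exp_bounded f"
  shows "exp_bounded (bessel_potential \<beta> f)"
proof -
  obtain M where M: "\<And>n. \<bar>f n\<bar> \<le> M * exp_weight n"
    using exp_boundedE[OF assms(1)] by metis
  let ?c = "gamma_avg (\<beta> / 2) (\<lambda>\<tau>. exp (\<tau> / 2))"
  have "\<bar>bessel_potential \<beta> f n\<bar> \<le> M * exp_weight n * ?c" for n
    unfolding bessel_potential_eq
    by (intro gamma_avg_bound half_pos heat_semigroup_measurable_0 heat_semigroup_growth assms M)
  then have "\<bar>bessel_potential \<beta> f n\<bar> \<le> (M * ?c) * exp_weight n" for n
    by (simp add: mult_ac)
  then show ?thesis unfolding exp_bounded_def by blast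
qed

text \<open>Expanding the outer semigroup in its exponential series, the powers of the neighbour sum commute with
the potential, and the series may be moved inside the integral over \<open>\<tau>\<close>. There it resums to
the semigroup at time \<open>t\<close> applied to the flow at time \<open>\<tau>\<close>.\<close>

lemma heat_semigroup_bessel_potential:
  assumes "exp_bounded f"
  shows "heat_semigroup t (bessel_potential \<beta> f) n = gamma_avg (\<beta> / 2) (\<lambda>\<tau>. heat_semigroup (t + \<tau>) f n)"
proof -
  obtain M where M: "\<And>k n. \<bar>(nbr_sum ^^ k) f n\<bar> \<le> (5 / 2) ^ k * (M * exp_weight n)"
    using exp_boundedE[OF assms(1)] by metis
  \<comment> \<open>The summand with coefficient \<open>0\<close> only brings the term into the shape of \<open>gamma_avg_linear\<close>.\<close>
  let ?F = "\<lambda>k \<tau>. exp (- 2 * t) * (t ^ k / fact k) * heat_semigroup \<tau> ((nbr_sum ^^ k) f) n + 0 * heat_semigroup \<tau> f n"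
  let ?K = "\<lambda>k. exp (- 2 * t) * ((\<bar>t\<bar> * (5 / 2)) ^ k / fact k * (M * exp_weight n))"
  note eb = exp_bounded_nbr_sum_pow[OF assms]
  have le: "\<bar>heat_semigroup \<tau> ((nbr_sum ^^ k) f) n\<bar> \<le> (5 / 2) ^ k * M * exp_weight n * exp (\<tau> / 2)"
    if "\<tau> > 0" for k \<tau>
    by (rule heat_semigroup_growth[OF eb _ that]) (use M in \<open>simp add: mult_ac\<close>)
  have F_le: "\<bar>?F k \<tau>\<bar> \<le> ?K k * exp (\<tau> / 2)" if "\<tau> > 0" for k \<tau>
  proof -
    have "exp (- 2 * t) * (\<bar>t\<bar> ^ k / fact k) * \<bar>heat_semigroup \<tau> ((nbr_sum ^^ k) f) n\<bar>
        \<le> exp (- 2 * t) * (\<bar>t\<bar> ^ k / fact k) * ((5 / 2) ^ k * M * exp_weight n * exp (\<tau> / 2))"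
      by (intro mult_left_mono le that) auto
    then show ?thesis
      by (simp add: abs_mult power_abs power_mult_distrib power_divide mult_ac)
  qed
  have "(\<lambda>k. gamma_avg (\<beta> / 2) (?F k)) sums gamma_avg (\<beta> / 2) (\<lambda>\<tau>. \<Sum>k. ?F k \<tau>)"
  proof (rule gamma_avg_series[OF half_pos])
    show "?F k \<in> borel_measurable borel" for k
      using heat_semigroup_measurable_0[OF eb[of k], of n] by simp
    show "summable ?K"
      by (intro summable_mult summable_mult2 summable_exp_real)
  qed (fact F_le)
  moreover have "gamma_avg (\<beta> / 2) (?F k) = exp (- 2 * t) * (t ^ k / fact k * (nbr_sum ^^ k) (bessel_potential \<beta> f) n)" for k
  proof -
    obtain L where L: "\<And>\<tau>. \<tau> > 0 \<Longrightarrow> \<bar>heat_semigroup \<tau> f n\<bar> \<le> L * exp (\<tau> / 2)"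
      using exp_boundedE_heat[OF assms(1)] by metis
    have "gamma_avg (\<beta> / 2) (?F k) =
        exp (- 2 * t) * (t ^ k / fact k) * gamma_avg (\<beta> / 2) (\<lambda>\<tau>. heat_semigroup \<tau> ((nbr_sum ^^ k) f) n)
        + 0 * gamma_avg (\<beta> / 2) (\<lambda>\<tau>. heat_semigroup \<tau> f n)"
      by (rule gamma_avg_linear[OF half_pos heat_semigroup_measurable_0[OF eb] le
            heat_semigroup_measurable_0[OF assms] L])
    also have "gamma_avg (\<beta> / 2) (\<lambda>\<tau>. heat_semigroup \<tau> ((nbr_sum ^^ k) f) n) = (nbr_sum ^^ k) (bessel_potential \<beta> f) n"
      by (simp flip: bessel_potential_eq bessel_potential_nbr_sum_pow[OF assms])
    finally show ?thesis by simp
  qed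
  moreover have "(\<lambda>k. exp (- 2 * t) * (t ^ k / fact k * (nbr_sum ^^ k) (bessel_potential \<beta> f) n))
      sums heat_semigroup t (bessel_potential \<beta> f) n"
    unfolding heat_semigroup_eq[OF exp_bounded_bessel_potential[OF assms]]
    by (intro sums_mult exp_nbr_sums exp_bounded_bessel_potential assms)
  ultimately have "heat_semigroup t (bessel_potential \<beta> f) n = gamma_avg (\<beta> / 2) (\<lambda>\<tau>. \<Sum>k. ?F k \<tau>)"
    using sums_unique2 by (metis (no_types, lifting) ext)
  also have "\<dots> = gamma_avg (\<beta> / 2) (\<lambda>\<tau>. heat_semigroup (t + \<tau>) f n)"
  proof -
    have "(\<Sum>k. ?F k \<tau>) = heat_semigroup (t + \<tau>) f n" if "\<tau> > 0" for \<tau>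
    proof -
      have "(\<lambda>k. exp (- 2 * t) * (t ^ k / fact k * (nbr_sum ^^ k) (heat_semigroup \<tau> f) n))
          sums heat_semigroup t (heat_semigroup \<tau> f) n"
        using that unfolding heat_semigroup_eq[OF exp_bounded_heat_semigroup[OF assms less_imp_le[OF that]]]
        by (intro sums_mult exp_nbr_sums exp_bounded_heat_semigroup assms) auto
      also have "heat_semigroup t (heat_semigroup \<tau> f) n = heat_semigroup (t + \<tau>) f n"
        using that by (intro heat_semigroup_add assms) auto
      finally show ?thesis
        by (simp add: heat_semigroup_nbr_sum_pow[OF assms] sums_iff mult.assoc)
    qed
    then show ?thesis
      unfolding gamma_avg_def
      by (intro arg_cong2[of _ _ _ _ "(*)"] set_lebesgue_integral_cong refl) auto
  qed
  finally show ?thesis .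
qed

end

section \<open>Polynomial growth\<close>

lemma powr_le_exp_weight:
  fixes a :: real
  obtains C where "C > 0" "\<And>n. 1 + \<bar>real_of_int n\<bar> powr a \<le> C * exp_weight n"
proof -
  have "(\<lambda>n. real n powr a / 2 ^ n) \<longlonglongrightarrow> 0"
    by real_asymp
  then have "Bseq (\<lambda>n. real n powr a / 2 ^ n)"
    by (intro convergent_imp_Bseq convergentI)
  then obtain K where K: "K > 0" "\<And>n. norm (real n powr a / 2 ^ n) \<le> K"
    by (auto elim: BseqE)
  have "1 + \<bar>real_of_int n\<bar> powr a \<le> (1 + K) * exp_weight n" for n
  proof -
    have "\<bar>real_of_int n\<bar> powr a \<le> K * 2 ^ nat \<bar>n\<bar>"
      using K(2)[of "nat \<bar>n\<bar>"] by (simp add: divide_le_eq)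
    also have "\<dots> \<le> K * exp_weight n"
      using K(1) by (intro mult_left_mono exp_weight_ge_pow) auto
    finally show ?thesis
      using exp_weight_ge_1[of n] by (simp add: algebra_simps)
  qed
  then show ?thesis using K(1) that[of "1 + K"] by simp
qed

lemma powr_add_le:
  fixes x y a :: real
  assumes "x \<ge> 0" "y \<ge> 0" "a \<ge> 0"
  shows "(x + y) powr a \<le> 2 powr a * (x powr a + y powr a)"
proof -
  have "(x + y) powr a \<le> (2 * max x y) powr a"
    using assms by (intro powr_mono2) auto
  also have "\<dots> = 2 powr a * (max x y) powr a"
    using assms by (simp add: powr_mult)
  also have "\<dots> \<le> 2 powr a * (x powr a + y powr a)"
    by (intro mult_left_mono) (auto simp: max_def)
  finally show ?thesis .
qed

text \<open>Polynomial weights are submultiplicative up to a constant, and exponentials dominate them: seen from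
\<open>n\<close>, the weight exceeds its own value at \<open>n\<close> at most by a multiple of the factor \<open>exp_weight j\<close>.\<close>

lemma poly_growth_shift:
  fixes a :: real
  assumes "a \<ge> 0"
  obtains C where "C > 0"
    "\<And>n j. 1 + \<bar>real_of_int (n + j)\<bar> powr a \<le> C * (1 + \<bar>real_of_int n\<bar> powr a) * exp_weight j"
proof -
  obtain C where C: "C > 0" "\<And>n. 1 + \<bar>real_of_int n\<bar> powr a \<le> C * exp_weight n"
    using powr_le_exp_weight[where a = a] by metis
  have "1 + \<bar>real_of_int (n + j)\<bar> powr a \<le> (2 powr a * C) * (1 + \<bar>real_of_int n\<bar> powr a) * exp_weight j" for n j
  proof -
    let ?x = "\<bar>real_of_int n\<bar> powr a" and ?y = "\<bar>real_of_int j\<bar> powr a"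
    have "\<bar>real_of_int (n + j)\<bar> powr a \<le> (\<bar>real_of_int n\<bar> + \<bar>real_of_int j\<bar>) powr a"
      using assms by (intro powr_mono2) auto
    also have "\<dots> \<le> 2 powr a * (?x + ?y)"
      using assms by (intro powr_add_le) auto
    finally have "1 + \<bar>real_of_int (n + j)\<bar> powr a \<le> 2 powr a * 1 + 2 powr a * (?x + ?y)"
      using ge_one_powr_ge_zero[of 2 a] assms by linarith
    also have "\<dots> \<le> 2 powr a * ((1 + ?x) * (1 + ?y))"
      by (simp add: algebra_simps)
    also have "\<dots> \<le> 2 powr a * ((1 + ?x) * (C * exp_weight j))"
      by (intro mult_left_mono C) auto
    finally show ?thesis by (simp add: mult_ac)
  qed
  then show ?thesis using C(1) that[of "2 powr a * C"] by simp
qed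

lemma poly_growth_exp_bounded:
  fixes a :: real
  assumes f: "\<And>n. \<bar>f n\<bar> \<le> M * (1 + \<bar>real_of_int n\<bar> powr a)"
  shows "exp_bounded f"
proof -
  obtain C where C: "C > 0" "\<And>n. 1 + \<bar>real_of_int n\<bar> powr a \<le> C * exp_weight n"
    using powr_le_exp_weight[where a = a] by metis
  have M: "M \<ge> 0" using f[of 0] by simp
  have "\<bar>f n\<bar> \<le> (M * C) * exp_weight n" for n
    using order_trans[OF f mult_left_mono[OF C(2) M]] by (simp add: mult_ac)
  then show ?thesis unfolding exp_bounded_def by blast
qed

text \<open>The domination by the weight centred at the origin would only give exponential growth in \<open>n\<close>.
Comparing with the weight centred at \<open>n\<close> itself, and evaluating at the centre, keeps the
polynomial rate.\<close>

lemma heat_semigroup_poly_growth: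
  fixes a :: real
  assumes a: "a \<ge> 0" and f: "\<And>n. \<bar>f n\<bar> \<le> M * (1 + \<bar>real_of_int n\<bar> powr a)"
  obtains K where "\<And>\<tau> n. \<tau> > 0 \<Longrightarrow> \<bar>heat_semigroup \<tau> f n\<bar> \<le> K * (1 + \<bar>real_of_int n\<bar> powr a) * exp (\<tau> / 2)"
proof -
  obtain C where C: "C > 0"
    "\<And>n j. 1 + \<bar>real_of_int (n + j)\<bar> powr a \<le> C * (1 + \<bar>real_of_int n\<bar> powr a) * exp_weight j"
    using poly_growth_shift[OF a] by metis
  have M: "M \<ge> 0" using f[of 0] by simp
  have "\<bar>heat_semigroup \<tau> f n\<bar> \<le> (2 * M * C) * (1 + \<bar>real_of_int n\<bar> powr a) * exp (\<tau> / 2)" if "\<tau> > 0" for \<tau> n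
  proof -
    let ?L = "M * C * (1 + \<bar>real_of_int n\<bar> powr a)"
    have le: "\<bar>f m\<bar> \<le> ?L * exp_weight (m - n)" for m
      using order_trans[OF f[of "n + (m - n)"] mult_left_mono[OF C(2)[of n "m - n"] M]] by (simp add: mult_ac)
    have w: "nbr_sum (\<lambda>m. ?L * exp_weight (m - n)) m \<le> 5 / 2 * (?L * exp_weight (m - n))" for m
    proof -
      have "nbr_sum (\<lambda>m. ?L * exp_weight (m - n)) m = ?L * nbr_sum exp_weight (m - n)"
        by (simp add: nbr_sum_def algebra_simps)
      then show ?thesis by (simp add: nbr_sum_exp_weight)
    qed
    have "\<bar>heat_semigroup \<tau> f n\<bar> \<le> exp ((5 / 2 - 2) * \<tau>) * (?L * exp_weight (n - n))"
      by (rule heat_semigroup_bound[OF poly_growth_exp_bounded[OF f] le w]) (use that in auto)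
    then show ?thesis by (simp add: exp_weight_def mult_ac)
  qed
  then show ?thesis by (rule that)
qed

lemma bessel_potential_poly_growth:
  fixes a :: real
  assumes "\<beta> > 0" and a: "a \<ge> 0" and f: "\<And>n. \<bar>f n\<bar> \<le> M * (1 + \<bar>real_of_int n\<bar> powr a)"
  obtains K where "\<And>n. \<bar>bessel_potential \<beta> f n\<bar> \<le> K * (1 + \<bar>real_of_int n\<bar> powr a)"
proof -
  obtain K where K: "\<And>\<tau> n. \<tau> > 0 \<Longrightarrow> \<bar>heat_semigroup \<tau> f n\<bar> \<le> K * (1 + \<bar>real_of_int n\<bar> powr a) * exp (\<tau> / 2)"
    using heat_semigroup_poly_growth[OF a f] by metis
  have "\<bar>bessel_potential \<beta> f n\<bar> \<le> K * (1 + \<bar>real_of_int n\<bar> powr a) * gamma_avg (\<beta> / 2) (\<lambda>\<tau>. exp (\<tau> / 2))" for n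
    unfolding bessel_potential_eq
    by (rule gamma_avg_bound[OF _ heat_semigroup_measurable_0[OF poly_growth_exp_bounded[OF f]] K])
       (use assms in auto)
  then show ?thesis
    by (intro that[of "K * gamma_avg (\<beta> / 2) (\<lambda>\<tau>. exp (\<tau> / 2))"]) (simp add: mult_ac)
qed

section \<open>Decay in time\<close>

text \<open>The factor \<open>exp (- \<tau>)\<close> is bounded by \<open>1\<close>; what remains is a multiple of a beta integral, finite
because of \<open>0 < b\<close> at the origin and of \<open>b < s\<close> at infinity. Splitting at \<open>\<tau> = t\<close>, where the roles
of \<open>t\<close> and \<open>\<tau>\<close> in \<open>t + \<tau>\<close> change, makes it explicit and shows the scaling in \<open>t\<close>.\<close>

lemma gamma_avg_decay:
  fixes G :: "real \<Rightarrow> real"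
  assumes b: "0 < b" "b < s" and t: "t > 0" and C: "C \<ge> 0"
    and G: "(\<lambda>\<tau>. G (t + \<tau>)) \<in> borel_measurable borel" "\<And>\<tau>. \<tau> > 0 \<Longrightarrow> \<bar>G \<tau>\<bar> \<le> C * \<tau> powr (- s)"
  shows "\<bar>gamma_avg b (\<lambda>\<tau>. G (t + \<tau>))\<bar> \<le> C * (1 / b + 1 / (s - b)) / Gamma b * t powr (b - s)"
proof -
  \<comment> \<open>Both majorants are charged at \<open>\<tau> = t\<close>; as a single point this does not affect the integrals.\<close>
  define g1 where "g1 \<tau> = C * t powr (- s) * (indicator {0..t} \<tau> * \<tau> powr (b - 1))" for \<tau>
  define g2 where "g2 \<tau> = C * (indicator {t..} \<tau> * \<tau> powr (b - 1 - s))" for \<tau>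
  have i1: "((\<lambda>\<tau>. \<tau> powr (b - 1)) has_integral (t powr b / b)) {0..t}"
    using has_integral_powr_from_0[of "b - 1" t] b t by simp
  have i2: "((\<lambda>\<tau>. \<tau> powr (b - 1 - s)) has_integral (t powr (b - s) / (s - b))) {t..}"
    using has_integral_powr_to_inf[of "b - 1 - s" t] b t by (simp add: minus_divide_right)
  have s1: "set_integrable lborel {0..t} (\<lambda>\<tau>. \<tau> powr (b - 1))"
    by (rule set_integrable_lborel_nonneg) (use i1 in auto)
  have s2: "set_integrable lborel {t..} (\<lambda>\<tau>. \<tau> powr (b - 1 - s))"
    by (rule set_integrable_lborel_nonneg) (use i2 in auto)
  have l1: "integrable lborel g1" "integral\<^sup>L lborel g1 = C * t powr (- s) * (t powr b / b)"
    using s1 set_borel_integral_eq_integral(2)[OF s1] integral_unique[OF i1]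
    by (simp_all add: g1_def[abs_def] set_integrable_def set_lebesgue_integral_def)
  have l2: "integrable lborel g2" "integral\<^sup>L lborel g2 = C * (t powr (b - s) / (s - b))"
    using s2 set_borel_integral_eq_integral(2)[OF s2] integral_unique[OF i2]
    by (simp_all add: g2_def[abs_def] set_integrable_def set_lebesgue_integral_def)
  have G': "\<bar>G (t + \<tau>)\<bar> \<le> C * t powr (- s)" "\<bar>G (t + \<tau>)\<bar> \<le> C * \<tau> powr (- s)" if "\<tau> > 0" for \<tau>
  proof -
    have "(t + \<tau>) powr (- s) \<le> t powr (- s)" "(t + \<tau>) powr (- s) \<le> \<tau> powr (- s)"
      using that t b by (intro powr_mono2'; simp)+
    then have "C * (t + \<tau>) powr (- s) \<le> C * t powr (- s)" "C * (t + \<tau>) powr (- s) \<le> C * \<tau> powr (- s)"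
      using C by (auto intro: mult_left_mono)
    then show "\<bar>G (t + \<tau>)\<bar> \<le> C * t powr (- s)" "\<bar>G (t + \<tau>)\<bar> \<le> C * \<tau> powr (- s)"
      using G(2)[of "t + \<tau>"] that t by (auto intro: order_trans)
  qed
  have le: "\<bar>exp (- \<tau>) * G (t + \<tau>) * \<tau> powr b / \<tau>\<bar> \<le> g1 \<tau> + g2 \<tau>" if "\<tau> > 0" for \<tau>
  proof -
    have "\<bar>exp (- \<tau>) * G (t + \<tau>) * \<tau> powr b / \<tau>\<bar> = exp (- \<tau>) * (\<bar>G (t + \<tau>)\<bar> * \<tau> powr (b - 1))"
      using that by (simp add: abs_mult powr_diff)
    also have "\<dots> \<le> 1 * (\<bar>G (t + \<tau>)\<bar> * \<tau> powr (b - 1))"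
      using that by (intro mult_right_mono) auto
    also have "\<dots> \<le> g1 \<tau> + g2 \<tau>"
    proof (cases "\<tau> \<le> t")
      case True
      have "\<bar>G (t + \<tau>)\<bar> * \<tau> powr (b - 1) \<le> C * t powr (- s) * \<tau> powr (b - 1)"
        by (intro mult_right_mono G' that) auto
      moreover have "g2 \<tau> \<ge> 0" using C by (simp add: g2_def)
      moreover have "g1 \<tau> = C * t powr (- s) * \<tau> powr (b - 1)"
        using True that by (simp add: g1_def)
      ultimately show ?thesis by linarith
    next
      case False
      have "\<bar>G (t + \<tau>)\<bar> * \<tau> powr (b - 1) \<le> C * \<tau> powr (- s) * \<tau> powr (b - 1)"
        by (intro mult_right_mono G' that) auto
      also have "\<dots> = g2 \<tau>"
        using False by (simp add: g2_def mult.assoc flip: powr_add)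
      finally show ?thesis using False by (simp add: g1_def)
    qed
    finally show ?thesis .
  qed
  have sum: "integrable lborel (\<lambda>\<tau>. g1 \<tau> + g2 \<tau>)"
    using l1 l2 by simp
  then have sg: "set_integrable lborel {0<..} (\<lambda>\<tau>. g1 \<tau> + g2 \<tau>)"
    unfolding set_integrable_def by (intro integrable_mult_indicator) auto
  have "\<bar>gamma_avg b (\<lambda>\<tau>. G (t + \<tau>))\<bar> \<le> 1 / Gamma b * (LINT \<tau>:{0<..}|lborel. g1 \<tau> + g2 \<tau>)"
  proof (rule gamma_avg_dominated[OF b(1) _ sg le])
    show "set_integrable lborel {0<..} (\<lambda>\<tau>. exp (- \<tau>) * G (t + \<tau>) * \<tau> powr b / \<tau>)"
    proof (rule set_integrable_bound[OF sg])
      show "set_borel_measurable lborel {0<..} (\<lambda>\<tau>. exp (- \<tau>) * G (t + \<tau>) * \<tau> powr b / \<tau>)"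
        unfolding set_borel_measurable_def using G(1) by measurable
      show "AE \<tau> in lborel. \<tau> \<in> {0<..} \<longrightarrow> norm (exp (- \<tau>) * G (t + \<tau>) * \<tau> powr b / \<tau>) \<le> norm (g1 \<tau> + g2 \<tau>)"
        unfolding real_norm_def by (intro AE_I2 impI order_trans[OF le abs_ge_self]) auto
    qed
  qed
  also have "\<dots> \<le> 1 / Gamma b * (LINT \<tau>|lborel. g1 \<tau> + g2 \<tau>)"
    unfolding set_lebesgue_integral_def
    using Gamma_real_pos[OF b(1)] C
    by (intro mult_left_mono integral_mono sg[unfolded set_integrable_def] sum)
       (auto simp: indicator_def g1_def g2_def)
  also have "(LINT \<tau>|lborel. g1 \<tau> + g2 \<tau>) = C * t powr (- s) * (t powr b / b) + C * (t powr (b - s) / (s - b))"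
    using l1 l2 by simp
  also have "\<dots> = C * (1 / b + 1 / (s - b)) * t powr (b - s)"
    by (simp add: diff_conv_add_uminus[of b s] powr_add ring_distribs mult_ac del: add_uminus_conv_diff)
  finally show ?thesis by simp
qed

text \<open>Each further Laplacian gains a factor \<open>1 / t\<close>: run the flow for half of the time to use the decay
already known, and spend the other half on smoothing. So the bound for the one derivative in
the definition of the classes passes to all derivatives of higher order.\<close>

lemma heat_semigroup_lap_pow_decay:
  fixes a :: real
  assumes f: "exp_bounded f" and "k \<le> m"
    and k: "\<And>t n. t > 0 \<Longrightarrow> \<bar>heat_semigroup t ((lap ^^ k) f) n\<bar> \<le> C * t powr (a - real k)"
  obtains D where "D \<ge> 0"
    "\<And>t n. t > 0 \<Longrightarrow> \<bar>heat_semigroup t ((lap ^^ m) f) n\<bar> \<le> D * t powr (a - real m)"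
proof -
  have "\<exists>D. \<forall>t>0. \<forall>n. \<bar>heat_semigroup t ((lap ^^ m) f) n\<bar> \<le> D * t powr (a - real m)"
    using \<open>k \<le> m\<close>
  proof (induction m rule: dec_induct)
    case base
    then show ?case using k by blast
  next
    case (step m)
    then obtain D where D: "\<And>t n. t > 0 \<Longrightarrow> \<bar>heat_semigroup t ((lap ^^ m) f) n\<bar> \<le> D * t powr (a - real m)"
      by blast
    have "\<bar>heat_semigroup t ((lap ^^ Suc m) f) n\<bar> \<le> (D * 2 * (1 / 2) powr (a - real m)) * t powr (a - real (Suc m))"
      if t: "t > 0" for t n
    proof -
      note m = exp_bounded_lap_pow[OF f, of m]
      have "heat_semigroup t ((lap ^^ Suc m) f) n = heat_semigroup (t / 2 + t / 2) (lap ((lap ^^ m) f)) n"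
        by simp
      also have "\<dots> = heat_semigroup (t / 2) (lap (heat_semigroup (t / 2) ((lap ^^ m) f))) n"
        using t m by (simp only: heat_semigroup_add[symmetric] exp_bounded_lap heat_semigroup_lap)
                     (simp add: heat_semigroup_add exp_bounded_lap flip: heat_semigroup_lap)
      also have "\<bar>\<dots>\<bar> \<le> D * (t / 2) powr (a - real m) / (t / 2)"
        by (rule heat_semigroup_lap_bound) (use D t in auto)
      also have "\<dots> = (D * 2 * (1 / 2) powr (a - real m)) * (t powr (a - real m) / t)"
        using t powr_mult[of "1 / 2" t "a - real m"] by simp
      also have "t powr (a - real m) / t = t powr (a - real (Suc m))"
        using t by (simp add: powr_diff powr_add algebra_simps)
      finally show ?thesis .
    qed
    then show ?case by blast
  qed
  then obtain D where D: "\<And>t n. t > 0 \<Longrightarrow> \<bar>heat_semigroup t ((lap ^^ m) f) n\<bar> \<le> D * t powr (a - real m)"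
    by blast
  have "D \<ge> 0" using D[of 1 0] by simp
  with D show ?thesis using that by blast
qed

section \<open>Bessel potentials in the Lipschitz classes\<close>

lemma sup_norm_le_iff: "sup_norm f \<le> ereal C \<longleftrightarrow> (\<forall>n. \<bar>f n\<bar> \<le> C)"
  by (simp add: sup_norm_def SUP_le_iff)

lemma ell_infty_iff: "f \<in> ell_infty \<longleftrightarrow> (\<exists>C. \<forall>n. \<bar>f n\<bar> \<le> C)"
proof
  assume "f \<in> ell_infty"
  then have "sup_norm f < \<infinity>" by (simp add: ell_infty_def)
  then obtain N where "sup_norm f < ereal (real N)"
    using less_PInf_Ex_of_nat[of "sup_norm f"] by auto
  then have "sup_norm f \<le> ereal (real N)" by simp
  then show "\<exists>C. \<forall>n. \<bar>f n\<bar> \<le> C" unfolding sup_norm_le_iff by blast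
next
  assume "\<exists>C. \<forall>n. \<bar>f n\<bar> \<le> C"
  then obtain C where "sup_norm f \<le> ereal C" unfolding sup_norm_le_iff by blast
  then show "f \<in> ell_infty" unfolding ell_infty_def using order.strict_trans1 by force
qed

lemma poly_growth_iff:
  "(\<lambda>n. f n / (1 + \<bar>real_of_int n\<bar> powr a)) \<in> ell_infty
    \<longleftrightarrow> (\<exists>M. \<forall>n. \<bar>f n\<bar> \<le> M * (1 + \<bar>real_of_int n\<bar> powr a))"
proof -
  have p: "1 + \<bar>real_of_int n\<bar> powr a > 0" for n
    by (intro add_pos_nonneg) auto
  have "\<bar>f n / (1 + \<bar>real_of_int n\<bar> powr a)\<bar> \<le> M \<longleftrightarrow> \<bar>f n\<bar> \<le> M * (1 + \<bar>real_of_int n\<bar> powr a)" for n M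
    using p[of n] by (simp add: abs_divide pos_divide_le_eq)
  then show ?thesis unfolding ell_infty_iff by simp
qed

text \<open>Both statements of the theorem are instances: membership in the class of order \<open>a\<close> provides the decay
with \<open>k\<close> the order of derivative belonging to \<open>a\<close>, and a bounded function has it with \<open>a = 0\<close>
and \<open>k = 0\<close>, by contractivity of the semigroup.\<close>

lemma bessel_potential_in_Lambda_H:
  fixes a \<beta> :: real
  assumes a: "a \<ge> 0" and \<beta>: "\<beta> > 0"
    and f: "\<And>n. \<bar>f n\<bar> \<le> M * (1 + \<bar>real_of_int n\<bar> powr a)"
    and k: "k \<le> nat \<lfloor>(a + \<beta>) / 2\<rfloor> + 1"
    and decay: "\<And>t n. t > 0 \<Longrightarrow> \<bar>heat_semigroup t ((lap ^^ k) f) n\<bar> \<le> C * t powr (a / 2 - real k)"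
  shows "bessel_potential \<beta> f \<in> Lambda_H (a + \<beta>)"
proof -
  define m where "m = nat \<lfloor>(a + \<beta>) / 2\<rfloor> + 1"
  note eb = poly_growth_exp_bounded[OF f]
  have m: "real m > (a + \<beta>) / 2"
    using a \<beta> unfolding m_def by linarith
  obtain K where K: "\<And>n. \<bar>bessel_potential \<beta> f n\<bar> \<le> K * (1 + \<bar>real_of_int n\<bar> powr a)"
    using bessel_potential_poly_growth[OF \<beta> a f] by metis
  have "K \<ge> 0" using K[of 0] by simp
  have "\<bar>bessel_potential \<beta> f n\<bar> \<le> 2 * K * (1 + \<bar>real_of_int n\<bar> powr (a + \<beta>))" for n
  proof -
    have "\<bar>real_of_int n\<bar> powr a \<le> 1 + \<bar>real_of_int n\<bar> powr (a + \<beta>)"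
    proof (cases "n = 0")
      case False
      then have "\<bar>real_of_int n\<bar> powr a \<le> \<bar>real_of_int n\<bar> powr (a + \<beta>)"
        using \<beta> by (intro powr_mono) linarith+
      then show ?thesis by simp
    qed simp
    moreover have "1 + x \<le> 2 * (1 + y)" if "x \<le> 1 + y" "0 \<le> y" for x y :: real
      using that by simp
    ultimately have "1 + \<bar>real_of_int n\<bar> powr a \<le> 2 * (1 + \<bar>real_of_int n\<bar> powr (a + \<beta>))"
      using powr_ge_zero by blast
    from order_trans[OF K mult_left_mono[OF this \<open>K \<ge> 0\<close>]] show ?thesis
      by (simp add: mult_ac)
  qed
  then have growth: "(\<lambda>n. bessel_potential \<beta> f n / (1 + \<bar>real_of_int n\<bar> powr (a + \<beta>))) \<in> ell_infty"
    unfolding poly_growth_iff by blast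
  obtain D where D: "D \<ge> 0"
    "\<And>t n. t > 0 \<Longrightarrow> \<bar>heat_semigroup t ((lap ^^ m) f) n\<bar> \<le> D * t powr (a / 2 - real m)"
    using heat_semigroup_lap_pow_decay[OF eb k[folded m_def] decay] by metis
  define s where "s = real m - a / 2"
  define E where "E = D * (1 / (\<beta> / 2) + 1 / (s - \<beta> / 2)) / Gamma (\<beta> / 2)"
  have "\<bar>(deriv ^^ m) (\<lambda>s. heat_semigroup s (bessel_potential \<beta> f) n) t\<bar> \<le> E * t powr (- real m + (a + \<beta>) / 2)"
    if t: "t > 0" for t n
  proof -
    have "(deriv ^^ m) (\<lambda>s. heat_semigroup s (bessel_potential \<beta> f) n) t
        = heat_semigroup t (bessel_potential \<beta> ((lap ^^ m) f)) n"
      by (simp add: deriv_heat_semigroup exp_bounded_bessel_potential[OF \<beta> eb] bessel_potential_lap_pow[OF \<beta> eb])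
    also have "\<dots> = gamma_avg (\<beta> / 2) (\<lambda>\<tau>. heat_semigroup (t + \<tau>) ((lap ^^ m) f) n)"
      by (rule heat_semigroup_bessel_potential[OF \<beta> exp_bounded_lap_pow[OF eb]])
    also have "\<bar>\<dots>\<bar> \<le> D * (1 / (\<beta> / 2) + 1 / (s - \<beta> / 2)) / Gamma (\<beta> / 2) * t powr (\<beta> / 2 - s)"
      by (rule gamma_avg_decay[where G = "\<lambda>\<tau>. heat_semigroup \<tau> ((lap ^^ m) f) n"])
         (use \<beta> m t D heat_semigroup_measurable[OF exp_bounded_lap_pow[OF eb]] in
           \<open>simp_all add: s_def add_divide_distrib\<close>)
    also have "\<beta> / 2 - s = - real m + (a + \<beta>) / 2"
      by (simp add: s_def field_simps)
    finally show ?thesis unfolding E_def .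
  qed
  then have "\<forall>t>0. sup_norm (\<lambda>n. (deriv ^^ m) (\<lambda>s. heat_semigroup s (bessel_potential \<beta> f) n) t)
      \<le> ereal (E * t powr (- real m + (a + \<beta>) / 2))"
    unfolding sup_norm_le_iff by blast
  with growth show ?thesis
    unfolding Lambda_H_def m_def Let_def mem_Collect_eq by blast
qed

theorem theorem2:
  fixes \<alpha> \<beta> :: real
  assumes "\<alpha> > 0" and "\<beta> > 0"
  shows "(\<forall>f. f \<in> Lambda_H \<alpha> \<longrightarrow> bessel_potential \<beta> f \<in> Lambda_H (\<alpha> + \<beta>)) \<and>
         (\<forall>f. f \<in> ell_infty \<longrightarrow> bessel_potential \<beta> f \<in> Lambda_H \<beta>)"
proof (intro conjI allI impI)
  fix f assume "f \<in> Lambda_H \<alpha>"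
  then obtain M C where f: "\<And>n. \<bar>f n\<bar> \<le> M * (1 + \<bar>real_of_int n\<bar> powr \<alpha>)"
    and C: "\<And>t n. t > 0 \<Longrightarrow> \<bar>(deriv ^^ (nat \<lfloor>\<alpha> / 2\<rfloor> + 1)) (\<lambda>s. heat_semigroup s f n) t\<bar>
      \<le> C * t powr (- real (nat \<lfloor>\<alpha> / 2\<rfloor> + 1) + \<alpha> / 2)"
    unfolding Lambda_H_def Let_def poly_growth_iff sup_norm_le_iff by blast
  show "bessel_potential \<beta> f \<in> Lambda_H (\<alpha> + \<beta>)"
  proof (rule bessel_potential_in_Lambda_H[OF _ _ f])
    show "nat \<lfloor>\<alpha> / 2\<rfloor> + 1 \<le> nat \<lfloor>(\<alpha> + \<beta>) / 2\<rfloor> + 1"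
      using assms by (intro add_right_mono nat_mono floor_mono) auto
    show "\<bar>heat_semigroup t ((lap ^^ (nat \<lfloor>\<alpha> / 2\<rfloor> + 1)) f) n\<bar>
        \<le> C * t powr (\<alpha> / 2 - real (nat \<lfloor>\<alpha> / 2\<rfloor> + 1))" if "t > 0" for t n
      using C[OF that, of n] unfolding deriv_heat_semigroup[OF poly_growth_exp_bounded[OF f]]
      by (simp only: minus_add_distrib diff_conv_add_uminus add.commute)
  qed (use assms in auto)
next
  fix f assume "f \<in> ell_infty"
  then obtain M where M: "\<And>n. \<bar>f n\<bar> \<le> M"
    unfolding ell_infty_iff by blast
  then have "M \<ge> 0" using M[of 0] by linarith
  have "bessel_potential \<beta> f \<in> Lambda_H (0 + \<beta>)"
  proof (rule bessel_potential_in_Lambda_H[where k = 0])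
    show "\<bar>f n\<bar> \<le> M * (1 + \<bar>real_of_int n\<bar> powr 0)" for n
      using M[of n] \<open>M \<ge> 0\<close> by (cases "n = 0") auto
    show "\<bar>heat_semigroup t ((lap ^^ 0) f) n\<bar> \<le> M * t powr (0 / 2 - real 0)" if "t > 0" for t n
      using heat_semigroup_contraction[of f, OF M, of t n] that by simp
  qed (use assms in auto)
  then show "bessel_potential \<beta> f \<in> Lambda_H \<beta>" by simp
qed

end
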